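(* Let $I\subseteq\mathbb{R}$ be an interval, let $G:I\to(0,1)$ be a continuous strictly increasing bijection, and let $X,X_1,X_2,\ldots$ be i.i.d. with law $P$, $P(I)=1$. Let $p_G=\mathbb{E}[G(X)]$, $b_G=G^{-1}(p_G)$, and assume that $G$ is continuously differentiable on a neighbourhood of $b_G$ with $G'(b_G)>0$. Put $\tau_G^2=\operatorname{Var}(G(X))/[G'(b_G)]^2$ and $\widehat b_G=G^{-1}\left(\frac1n\sum_{i=1}^nG(X_i)\right)$. Given $X_1,\ldots,X_n$, let $X_1^*,\ldots,X_n^*$ be drawn i.i.d. from the empirical distribution $\frac1n\sum_{i=1}^n\delta_{X_i}$ and let $\widehat b_G^*=G^{-1}\left(\frac1n\sum_{i=1}^nG(X_i^* )\right)$. Then, conditionally on the data, $$\sqrt n\,(\widehat b_G^*-\widehat b_G)\rightsquigarrow\mathcal N(0,\tau_G^2)\quad\text{in probability}$$ as $n\to\infty$. Hence the bootstrap consistently estimates the first-order distribution of $\sqrt n(\widehat b_G-b_G)$: the bounded-Lipschitz distance between the conditional law of $\sqrt n(\widehat b_G^*-\widehat b_G)$ given the data and the law of $\sqrt n(\widehat b_G-b_G)$ tends to $0$ in probability.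
   Context: Conditional weak convergence in probability of $Z_n^*$ to a law $L$ means that the bounded-Lipschitz distance between the conditional law of $Z_n^*$ given $X_1,\ldots,X_n$ and $L$ tends to $0$ in probability, where the bounded-Lipschitz distance of two laws $\mu,\nu$ is $\sup|\int h\,d\mu-\int h\,d\nu|$ over $h$ with $\|h\|_\infty\le1$ and Lipschitz constant at most $1$. $\mathcal N(0,0)$ denotes the point mass at $0$. *)

theory Defs
  imports "HOL-Probability.Probability"
begin

text \<open>The generalised mean \<open>G\<^sup>-\<^sup>1 ((G x\<^sub>1 + \<dots> + G x\<^sub>n) / n)\<close>, with the sample
  \<open>x\<close> indexed from 1.\<close>

definition gmean :: "real set \<Rightarrow> (real \<Rightarrow> real) \<Rightarrow> nat \<Rightarrow> (nat \<Rightarrow> real) \<Rightarrow> real" where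
  "gmean I G n x = the_inv_into I G ((\<Sum>i=1..n. G (x i)) / real n)"

text \<open>The pushforward of the uniform index law is \<open>(\<delta>\<^bsub>x 1\<^esub> + \<dots> + \<delta>\<^bsub>x n\<^esub>) / n\<close>: tied
  observations add up their masses. Only \<open>n > 0\<close> is meaningful.\<close>

definition empirical_pmf :: "nat \<Rightarrow> (nat \<Rightarrow> real) \<Rightarrow> real pmf" where
  "empirical_pmf n x = map_pmf x (pmf_of_set {1..n})"

text \<open>The joint law of \<open>n\<close> i.i.d. draws from the empirical distribution of \<open>x 1, \<dots>, x n\<close>;
  coordinates outside \<open>{1..n}\<close> carry the dummy value 0.\<close>

definition resample_pmf :: "nat \<Rightarrow> (nat \<Rightarrow> real) \<Rightarrow> (nat \<Rightarrow> real) pmf" where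
  "resample_pmf n x = Pi_pmf {1..n} 0 (\<lambda>_. empirical_pmf n x)"

text \<open>The conditional law of the bootstrap root given that the data equal \<open>x\<close>.\<close>

definition boot_law :: "real set \<Rightarrow> (real \<Rightarrow> real) \<Rightarrow> nat \<Rightarrow> (nat \<Rightarrow> real) \<Rightarrow> real measure" where
  "boot_law I G n x =
     distr (measure_pmf (resample_pmf n x)) borel
       (\<lambda>y. sqrt (real n) * (gmean I G n y - gmean I G n x))"

definition bl_dist :: "real measure \<Rightarrow> real measure \<Rightarrow> real" where
  "bl_dist \<mu> \<nu> =
     (SUP h \<in> {h :: real \<Rightarrow> real. (\<forall>x. \<bar>h x\<bar> \<le> 1) \<and> 1-lipschitz_on UNIV h}.
        \<bar>(\<integral>x. h x \<partial>\<mu>) - (\<integral>x. h x \<partial>\<nu>)\<bar>)"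

text \<open>Parametrised by the variance; the library's \<open>normal_density\<close> takes the standard
  deviation and gives no point mass for deviation 0.\<close>

definition normal_law :: "real \<Rightarrow> real \<Rightarrow> real measure" where
  "normal_law m v =
     (if v = 0 then return borel m
      else density lborel (\<lambda>x. ennreal (normal_density m (sqrt v) x)))"

text \<open>Measurability is part of the definition because \<open>measure\<close> is 0 on nonmeasurable sets.\<close>

definition tendsto_in_prob :: "'a measure \<Rightarrow> (nat \<Rightarrow> 'a \<Rightarrow> real) \<Rightarrow> real \<Rightarrow> bool" where
  "tendsto_in_prob M Y c \<longleftrightarrow>
     (\<forall>n. Y n \<in> borel_measurable M) \<and>
     (\<forall>\<epsilon>>0. (\<lambda>n. measure M {\<omega> \<in> space M. \<bar>Y n \<omega> - c\<bar> > \<epsilon>}) \<longlonglongrightarrow> 0)"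

text \<open>Conditional weak convergence in probability, for random laws \<open>K n \<omega>\<close>.\<close>

definition cond_weak_conv_in_prob ::
  "'a measure \<Rightarrow> (nat \<Rightarrow> 'a \<Rightarrow> real measure) \<Rightarrow> real measure \<Rightarrow> bool" where
  "cond_weak_conv_in_prob M K L \<longleftrightarrow> tendsto_in_prob M (\<lambda>n \<omega>. bl_dist (K n \<omega>) L) 0"

end

theory Submission
  imports Defs
begin

text \<open>
  Given the data, the bootstrap draws form a row of bounded i.i.d. variables whose mean and
  variance are the empirical ones. A central limit theorem for such triangular arrays, followed by
  the delta method for \<open>G\<^sup>-\<^sup>1\<close> and Skorohod's representation, gives bounded-Lipschitz convergence along every
  \<^emph>\<open>deterministic\<close> sequence of data sets whose first two empirical moments of \<open>G\<close> converge. By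
  contradiction this is uniform over data sets with empirical moments close to the true ones,
  and the weak law of large numbers makes that event likely. The sampling distribution of the original
  root is handled by the same array theorem, and the triangle inequality compares the two.
\<close>

section \<open>Bounded-Lipschitz distance\<close>

text \<open>The centring \<open>H (m k)\<close> of the bootstrap root drifts with the data and is
  only known to tend to \<open>b\<close>. A derivative of the inverse at one point does not control
  difference quotients between two drifting points; continuity of \<open>deriv G\<close> near
  \<open>b\<close> does. The drift also makes the rescaled maps depend on \<open>k\<close>, hence an
  extended continuous mapping argument instead of the ordinary one. Since \<open>G\<close> has
  values in (0,1), centred variables are bounded by 1, and the error in the characteristic functions
  depends on \<open>n\<close> and \<open>t\<close> alone: it is uniform over all row laws, so no
  Lindeberg condition has to be verified for empirical laws. A vanishing variance is covered by the
  same estimates, because the limit is a scaled standard normal law and the scale 0 gives the point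
  mass. Convergence in probability includes measurability of the distance as a function of the data.
  This rests on two reductions: the supremum over test functions becomes countable, and the
  conditional expectation becomes an average over a finite set of index vectors that does not depend
  on the data.\<close>

definition bl_functions :: "(real \<Rightarrow> real) set" where
  "bl_functions = {h. (\<forall>x. \<bar>h x\<bar> \<le> 1) \<and> 1-lipschitz_on UNIV h}"

lemma bl_dist_alt:
  "bl_dist \<mu> \<nu> = (SUP h \<in> bl_functions. \<bar>(\<integral>x. h x \<partial>\<mu>) - (\<integral>x. h x \<partial>\<nu>)\<bar>)"
  by (simp add: bl_dist_def bl_functions_def)

lemma bl_functions_bound: "h \<in> bl_functions \<Longrightarrow> \<bar>h x\<bar> \<le> 1"
  by (simp add: bl_functions_def)

lemma bl_functions_lipschitz: "h \<in> bl_functions \<Longrightarrow> \<bar>h x - h y\<bar> \<le> \<bar>x - y\<bar>"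
  using lipschitz_onD[of 1 UNIV h x y] by (auto simp: bl_functions_def dist_real_def)

lemma bl_functions_measurable [measurable (raw)]:
  assumes "h \<in> bl_functions" "f \<in> borel_measurable M"
  shows "(\<lambda>x. h (f x)) \<in> borel_measurable M"
proof -
  have "continuous_on UNIV h"
    using assms(1) by (auto simp: bl_functions_def intro: lipschitz_on_continuous_on)
  then have "h \<in> borel_measurable borel"
    by (rule borel_measurable_continuous_onI)
  then show ?thesis using assms(2) by (rule measurable_compose_rev)
qed

lemma zero_in_bl_functions: "(\<lambda>_. 0) \<in> bl_functions"
  by (auto simp: bl_functions_def lipschitz_on_def)

lemma (in prob_space) integrable_bl:
  assumes "h \<in> bl_functions" "f \<in> borel_measurable M"
  shows "integrable M (\<lambda>x. h (f x))"
  by (rule integrable_const_bound[where B = 1])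
     (use assms bl_functions_bound in \<open>auto intro: bl_functions_measurable\<close>)

lemma (in real_distribution) integral_bl_bound:
  assumes "h \<in> bl_functions"
  shows "\<bar>\<integral>x. h x \<partial>M\<bar> \<le> 1"
proof -
  have i: "integrable M h" using integrable_bl[OF assms, of "\<lambda>x. x"] by simp
  have "(\<integral>x. h x \<partial>M) \<le> 1" 
    by (rule integral_le_const[OF i]) (use bl_functions_bound[OF assms] abs_le_D1 in auto)
  moreover have "-1 \<le> (\<integral>x. h x \<partial>M)" 
    by (rule integral_ge_const[OF i], rule AE_I2) (use bl_functions_bound[OF assms] in \<open>simp add: abs_le_iff minus_le_iff\<close>)
  ultimately show ?thesis by simp
qed

lemma integral_bl_diff_bound:
  assumes "real_distribution \<mu>" "real_distribution \<nu>" "h \<in> bl_functions"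
  shows "\<bar>(\<integral>x. h x \<partial>\<mu>) - (\<integral>x. h x \<partial>\<nu>)\<bar> \<le> 2"
  using real_distribution.integral_bl_bound[OF assms(1,3)]
    real_distribution.integral_bl_bound[OF assms(2,3)] by linarith

lemma bl_dist_upper:
  assumes "real_distribution \<mu>" "real_distribution \<nu>" "h \<in> bl_functions"
  shows "\<bar>(\<integral>x. h x \<partial>\<mu>) - (\<integral>x. h x \<partial>\<nu>)\<bar> \<le> bl_dist \<mu> \<nu>"
  unfolding bl_dist_alt using assms integral_bl_diff_bound
  by (intro cSUP_upper bdd_aboveI2[where M = 2]) auto

lemma bl_dist_least:
  assumes "\<And>h. h \<in> bl_functions \<Longrightarrow> \<bar>(\<integral>x. h x \<partial>\<mu>) - (\<integral>x. h x \<partial>\<nu>)\<bar> \<le> c"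
  shows "bl_dist \<mu> \<nu> \<le> c"
  unfolding bl_dist_alt using assms zero_in_bl_functions by (intro cSUP_least) auto

lemma bl_dist_nonneg:
  assumes "real_distribution \<mu>" "real_distribution \<nu>"
  shows "0 \<le> bl_dist \<mu> \<nu>"
  using bl_dist_upper[OF assms zero_in_bl_functions] by simp

lemma bl_dist_commute: "bl_dist \<mu> \<nu> = bl_dist \<nu> \<mu>"
  unfolding bl_dist_def by (simp add: abs_minus_commute)

lemma bl_dist_triangle:
  assumes "real_distribution \<mu>" "real_distribution \<nu>" "real_distribution \<rho>"
  shows "bl_dist \<mu> \<rho> \<le> bl_dist \<mu> \<nu> + bl_dist \<nu> \<rho>"
proof (rule bl_dist_least)
  fix h assume "h \<in> bl_functions"
  then show "\<bar>(\<integral>x. h x \<partial>\<mu>) - (\<integral>x. h x \<partial>\<rho>)\<bar> \<le> bl_dist \<mu> \<nu> + bl_dist \<nu> \<rho>"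
    using bl_dist_upper[OF assms(1,2), of h] bl_dist_upper[OF assms(2,3), of h] by linarith
qed

text \<open>A test function changes by at most \<open>\<bar>f x - g x\<bar>\<close> by the Lipschitz
  condition and by at most 2 by its bound, so every coupling bounds the distance. The cut at 2
  supplies the dominating constant when this is combined with pointwise convergence.\<close>

lemma (in prob_space) bl_dist_coupling:
  assumes [measurable]: "f \<in> borel_measurable M" "g \<in> borel_measurable M"
  shows "bl_dist (distr M borel f) (distr M borel g) \<le> expectation (\<lambda>x. min 2 \<bar>f x - g x\<bar>)"
proof (rule bl_dist_least)
  fix h assume h: "h \<in> bl_functions"
  have hm: "h \<in> borel_measurable borel"
    using bl_functions_measurable[OF h, of "\<lambda>x. x" borel] by simp
  have "(\<integral>x. h x \<partial>distr M borel f) - (\<integral>x. h x \<partial>distr M borel g)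
      = expectation (\<lambda>x. h (f x) - h (g x))"
    using integrable_bl[OF h, of f] integrable_bl[OF h, of g] hm
    by (simp add: integral_distr)
  also have "\<bar>\<dots>\<bar> \<le> expectation (\<lambda>x. \<bar>h (f x) - h (g x)\<bar>)"
    by (rule integral_abs_bound)
  also have "\<dots> \<le> expectation (\<lambda>x. min 2 \<bar>f x - g x\<bar>)"
  proof (rule integral_mono)
    show "integrable M (\<lambda>x. \<bar>h (f x) - h (g x)\<bar>)"
      using integrable_bl[OF h, of f] integrable_bl[OF h, of g] by simp
    show "integrable M (\<lambda>x. min 2 \<bar>f x - g x\<bar>)"
      by (rule integrable_const_bound[where B = 2]) auto
    show "\<bar>h (f x) - h (g x)\<bar> \<le> min 2 \<bar>f x - g x\<bar>" for x
      using bl_functions_lipschitz[OF h, of "f x" "g x"] bl_functions_bound[OF h, of "f x"]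
        bl_functions_bound[OF h, of "g x"] by auto
  qed
  finally show "\<bar>(\<integral>x. h x \<partial>distr M borel f) - (\<integral>x. h x \<partial>distr M borel g)\<bar>
      \<le> expectation (\<lambda>x. min 2 \<bar>f x - g x\<bar>)" .
qed

text \<open>The maps vary with \<open>k\<close>, so \<open>cont\<close> asks for continuous
  convergence: values along every convergent sequence of arguments converge. Skorohod's
  representation turns weak convergence into pointwise convergence on one probability space, and the
  coupling bound with dominated convergence finishes.\<close>

lemma bl_dist_extended_continuous_mapping:
  fixes \<mu> :: "nat \<Rightarrow> real measure"
  assumes \<mu>: "\<And>k. real_distribution (\<mu> k)" and \<nu>: "real_distribution \<nu>"
    and weak: "weak_conv_m \<mu> \<nu>"
    and f: "\<And>k. f k \<in> borel_measurable borel" and g: "g \<in> borel_measurable borel"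
    and cont: "\<And>s s0. s \<longlonglongrightarrow> s0 \<Longrightarrow> (\<lambda>k. f k (s k)) \<longlonglongrightarrow> g s0"
  shows "(\<lambda>k. bl_dist (distr (\<mu> k) borel (f k)) (distr \<nu> borel g)) \<longlonglongrightarrow> 0"
proof -
  obtain \<Omega> :: "real measure" and Z Z0 where "prob_space \<Omega>"
    and Z[measurable]: "\<And>k. Z k \<in> borel_measurable \<Omega>" and dZ: "\<And>k. distr \<Omega> borel (Z k) = \<mu> k"
    and Z0: "Z0 \<in> measurable \<Omega> lborel" and dZ0: "distr \<Omega> borel Z0 = \<nu>"
    and lim: "\<And>x. x \<in> space \<Omega> \<Longrightarrow> (\<lambda>k. Z k x) \<longlonglongrightarrow> Z0 x"
    using Skorohod[OF \<mu> \<nu> weak] by blast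
  have Z0'[measurable]: "Z0 \<in> borel_measurable \<Omega>" using Z0 by simp
  note f[measurable] g[measurable]
  interpret \<Omega>: prob_space \<Omega> by fact
  have "(\<lambda>k. \<Omega>.expectation (\<lambda>x. min 2 \<bar>f k (Z k x) - g (Z0 x)\<bar>)) \<longlonglongrightarrow> \<Omega>.expectation (\<lambda>x. 0)"
  proof (rule integral_dominated_convergence[where w = "\<lambda>_. 2"])
    show "AE x in \<Omega>. (\<lambda>k. min 2 \<bar>f k (Z k x) - g (Z0 x)\<bar>) \<longlonglongrightarrow> 0"
    proof (rule AE_I2)
      fix x assume "x \<in> space \<Omega>"
      then have "(\<lambda>k. f k (Z k x)) \<longlonglongrightarrow> g (Z0 x)" by (intro cont lim)
      then have "(\<lambda>k. \<bar>f k (Z k x) - g (Z0 x)\<bar>) \<longlonglongrightarrow> 0"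
        by (simp add: LIM_zero tendsto_rabs_zero)
      then show "(\<lambda>k. min 2 \<bar>f k (Z k x) - g (Z0 x)\<bar>) \<longlonglongrightarrow> 0"
        using tendsto_min[OF tendsto_const[of 2]] by fastforce
    qed
  qed auto
  then have lim0: "(\<lambda>k. \<Omega>.expectation (\<lambda>x. min 2 \<bar>f k (Z k x) - g (Z0 x)\<bar>)) \<longlonglongrightarrow> 0" by simp
  have eq: "distr (\<mu> k) borel (f k) = distr \<Omega> borel (\<lambda>x. f k (Z k x))"
    "distr \<nu> borel g = distr \<Omega> borel (\<lambda>x. g (Z0 x))" for k
    unfolding dZ[symmetric] dZ0[symmetric] by (simp_all add: distr_distr comp_def)
  show ?thesis
  proof (rule tendsto_sandwich[OF _ _ tendsto_const lim0])
    show "\<forall>\<^sub>F k in sequentially. 0 \<le> bl_dist (distr (\<mu> k) borel (f k)) (distr \<nu> borel g)"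
      unfolding eq by (intro always_eventually allI bl_dist_nonneg \<Omega>.real_distribution_distr) auto
    show "\<forall>\<^sub>F k in sequentially. bl_dist (distr (\<mu> k) borel (f k)) (distr \<nu> borel g)
        \<le> \<Omega>.expectation (\<lambda>x. min 2 \<bar>f k (Z k x) - g (Z0 x)\<bar>)"
      unfolding eq by (intro always_eventually allI \<Omega>.bl_dist_coupling) auto
  qed
qed

text \<open>Restriction to the rationals embeds the test functions into a second countable space;
  the common Lipschitz constant extends convergence on the rationals to the whole line. This
  makes the supremum in the distance a countable one, hence measurable.\<close>

lemma bl_functions_countable_dense:
  obtains D where "countable D" "D \<subseteq> bl_functions"
    "\<And>h. h \<in> bl_functions \<Longrightarrow> \<exists>d. (\<forall>k. d k \<in> D) \<and> (\<forall>x. (\<lambda>k::nat. d k x) \<longlonglongrightarrow> h x)"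
proof -
  let ?r = "\<lambda>h (q::rat). h (real_of_rat q) :: real"
  obtain T where T: "countable T" "T \<subseteq> ?r ` bl_functions" "?r ` bl_functions \<subseteq> closure T"
    using separable[of "?r ` bl_functions"] .
  obtain D where D: "countable D" "D \<subseteq> bl_functions" "T = ?r ` D"
    using T(1,2) countable_subset_image[of T ?r bl_functions] by auto
  show ?thesis
  proof (rule that[OF D(1,2)])
    fix h assume h: "h \<in> bl_functions"
    then have "?r h \<in> closure T" using T(3) by auto
    then obtain t where t: "\<And>k. t k \<in> T" "t \<longlonglongrightarrow> ?r h"
      unfolding closure_sequential by auto
    have "\<forall>k. \<exists>d\<in>D. t k = ?r d" using t(1) D(3) by auto
    then obtain d where d: "\<And>k. d k \<in> D" "\<And>k. t k = ?r (d k)" by metis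
    have lim_rat: "(\<lambda>k. d k (real_of_rat q)) \<longlonglongrightarrow> h (real_of_rat q)" for q
    proof -
      have "continuous_on UNIV (\<lambda>u :: rat \<Rightarrow> real. u q)" by (rule continuous_on_product_coordinates)
      then have "isCont (\<lambda>u :: rat \<Rightarrow> real. u q) (?r h)"
        using continuous_on_eq_continuous_at[OF open_UNIV] by blast
      from isCont_tendsto_compose[OF this t(2)] show ?thesis by (simp add: d(2))
    qed
    have "(\<lambda>k. d k x) \<longlonglongrightarrow> h x" for x
    proof (rule LIMSEQ_I)
      fix e :: real assume "e > 0"
      then obtain q where q: "q \<in> \<rat>" "x < q" "q < x + e / 3"
        using Rats_dense_in_real[of x "x + e / 3"] by auto
      then obtain q' where q': "q = real_of_rat q'" by (auto elim: Rats_cases)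
      obtain N where N: "\<And>k. k \<ge> N \<Longrightarrow> \<bar>d k q - h q\<bar> < e / 3"
        using LIMSEQ_D[OF lim_rat[of q'], of "e / 3"] \<open>e > 0\<close> q' by auto
      have "\<bar>d k x - h x\<bar> < e" if "k \<ge> N" for k
      proof -
        have "d k \<in> bl_functions" using d(1) D(2) by auto
        from bl_functions_lipschitz[OF this, of x q] bl_functions_lipschitz[OF h, of x q] N[OF that] q
        show ?thesis by linarith
      qed
      then show "\<exists>N. \<forall>k\<ge>N. norm (d k x - h x) < e" by auto
    qed
    then show "\<exists>d. (\<forall>k. d k \<in> D) \<and> (\<forall>x. (\<lambda>k. d k x) \<longlonglongrightarrow> h x)" using d(1) by blast
  qed
qed

text \<open>Pointwise limits of test functions pass to the integrals under both laws by dominated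
  convergence with bound 1. Hence the supremum may be taken over the countable set \<open>D\<close>,
  where measurability is preserved.\<close>

lemma borel_measurable_bl_dist:
  assumes K: "\<And>\<omega>. real_distribution (K \<omega>)" and L: "real_distribution L"
    and meas: "\<And>h. h \<in> bl_functions \<Longrightarrow> (\<lambda>\<omega>. \<integral>x. h x \<partial>K \<omega>) \<in> borel_measurable N"
  shows "(\<lambda>\<omega>. bl_dist (K \<omega>) L) \<in> borel_measurable N"
proof -
  obtain D where D: "countable D" "D \<subseteq> bl_functions"
    and dense: "\<And>h. h \<in> bl_functions \<Longrightarrow> \<exists>d. (\<forall>k. d k \<in> D) \<and> (\<forall>x. (\<lambda>k::nat. d k x) \<longlonglongrightarrow> h x)"
    using bl_functions_countable_dense by blast
  have ne: "D \<noteq> {}" using dense[OF zero_in_bl_functions] by auto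
  have bdd: "bdd_above ((\<lambda>h. \<bar>(\<integral>x. h x \<partial>K \<omega>) - (\<integral>x. h x \<partial>L)\<bar>) ` D)" for \<omega>
    using D(2) integral_bl_diff_bound[OF K L] by (intro bdd_aboveI2[where M = 2]) auto
  have eq: "bl_dist (K \<omega>) L = (SUP h \<in> D. \<bar>(\<integral>x. h x \<partial>K \<omega>) - (\<integral>x. h x \<partial>L)\<bar>)" for \<omega>
  proof (rule antisym)
    show "bl_dist (K \<omega>) L \<le> (SUP h \<in> D. \<bar>(\<integral>x. h x \<partial>K \<omega>) - (\<integral>x. h x \<partial>L)\<bar>)"
    proof (rule bl_dist_least)
      fix h assume h: "h \<in> bl_functions"
      obtain d where d: "\<And>k::nat. d k \<in> D" "\<And>x. (\<lambda>k. d k x) \<longlonglongrightarrow> h x"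
        using dense[OF h] by auto
      have conv: "(\<lambda>k. \<integral>x. d k x \<partial>\<mu>) \<longlonglongrightarrow> (\<integral>x. h x \<partial>\<mu>)" if "real_distribution \<mu>" for \<mu>
      proof -
        interpret real_distribution \<mu> by fact
        have m: "f \<in> borel_measurable \<mu>" if "f \<in> bl_functions" for f
          using bl_functions_measurable[OF that, of "\<lambda>x. x" \<mu>] by simp
        show ?thesis
        proof (rule integral_dominated_convergence[where w = "\<lambda>_. 1"])
          show "AE x in \<mu>. (\<lambda>k. d k x) \<longlonglongrightarrow> h x" using d(2) by simp
          show "AE x in \<mu>. norm (d k x) \<le> 1" for k
            using bl_functions_bound d(1) D(2) by (simp add: subset_iff)
        qed (use m[OF h] m[OF subsetD[OF D(2) d(1)]] in auto)
      qed
      have "(\<lambda>k. \<bar>(\<integral>x. d k x \<partial>K \<omega>) - (\<integral>x. d k x \<partial>L)\<bar>) \<longlonglongrightarrow> \<bar>(\<integral>x. h x \<partial>K \<omega>) - (\<integral>x. h x \<partial>L)\<bar>"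
        by (intro tendsto_intros conv K L)
      then show "\<bar>(\<integral>x. h x \<partial>K \<omega>) - (\<integral>x. h x \<partial>L)\<bar>
          \<le> (SUP h \<in> D. \<bar>(\<integral>x. h x \<partial>K \<omega>) - (\<integral>x. h x \<partial>L)\<bar>)"
        by (rule LIMSEQ_le_const2) (use d(1) bdd in \<open>auto intro!: exI[of _ 0] cSUP_upper2\<close>)
    qed
    show "(SUP h \<in> D. \<bar>(\<integral>x. h x \<partial>K \<omega>) - (\<integral>x. h x \<partial>L)\<bar>) \<le> bl_dist (K \<omega>) L"
      using ne D(2) by (intro cSUP_least bl_dist_upper K L) auto
  qed
  show ?thesis
    unfolding eq
  proof (rule borel_measurable_cSUP[OF D(1) _ bdd])
    fix h assume "h \<in> D"
    then have [measurable]: "(\<lambda>\<omega>. \<integral>x. h x \<partial>K \<omega>) \<in> borel_measurable N" using D(2) meas by auto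
    show "(\<lambda>\<omega>. \<bar>(\<integral>x. h x \<partial>K \<omega>) - (\<integral>x. h x \<partial>L)\<bar>) \<in> borel_measurable N" by measurable
  qed
qed

section \<open>A central limit theorem for bounded triangular arrays\<close>

text \<open>This joins the two cases of \<open>normal_law\<close>: scaling by 0 yields the point
  mass. Later facts about limit laws, including the degenerate one, follow from the standard normal
  law without splitting on the variance.\<close>

lemma normal_law_conv_distr:
  assumes "v \<ge> 0"
  shows "normal_law 0 v = distr std_normal_distribution borel (\<lambda>x. sqrt v * x)"
proof (cases "v = 0")
  case True
  interpret real_distribution std_normal_distribution by (rule real_dist_normal_dist)
  show ?thesis using True by (simp add: normal_law_def)
next
  case False
  interpret real_distribution std_normal_distribution by (rule real_dist_normal_dist)
  have v: "sqrt v > 0" using False assms by simp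
  have "distributed std_normal_distribution lborel (\<lambda>x. x) std_normal_density"
    by (simp add: distributed_def distr_id2)
  then have "distributed std_normal_distribution lborel (\<lambda>x. 0 + sqrt v * x) (normal_density (0 + sqrt v * 0) (\<bar>sqrt v\<bar> * 1))"
    by (rule normal_density_affine) (use v in auto)
  then have "distributed std_normal_distribution lborel (\<lambda>x. sqrt v * x) (normal_density 0 (sqrt v))"
    using v by simp
  then have "density lborel (normal_density 0 (sqrt v)) = distr std_normal_distribution lborel (\<lambda>x. sqrt v * x)"
    by (simp add: distributed_def)
  also have "\<dots> = distr std_normal_distribution borel (\<lambda>x. sqrt v * x)"
    by (rule distr_cong) auto
  finally show ?thesis using False by (simp add: normal_law_def)
qed

lemma real_distribution_normal_law:
  assumes "v \<ge> 0" shows "real_distribution (normal_law 0 v)"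
proof -
  interpret real_distribution std_normal_distribution by (rule real_dist_normal_dist)
  show ?thesis unfolding normal_law_conv_distr[OF assms] by simp
qed

lemma distr_normal_law_scale:
  assumes "v \<ge> 0" "c \<ge> 0"
  shows "distr (normal_law 0 v) borel (\<lambda>x. c * x) = normal_law 0 (c\<^sup>2 * v)"
  using assms by (simp add: normal_law_conv_distr distr_distr comp_def real_sqrt_mult mult_ac)

lemma char_normal_law:
  assumes "v \<ge> 0" shows "char (normal_law 0 v) t = exp (- (t\<^sup>2 * v / 2))"
proof -
  have "char (normal_law 0 v) t = char std_normal_distribution (t * sqrt v)"
    unfolding normal_law_conv_distr[OF assms] char_def
    by (subst integral_distr) (auto simp: mult_ac)
  then show ?thesis using assms by (simp add: char_std_normal_distribution power_mult_distrib exp_of_real)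
qed

text \<open>The upper half comes from (1 - x + x^2/2)(1 + x + x^2/2) = 1 + x^4/4, which is at least
  1, together with \<open>exp x\<close> being at least the second factor for nonnegative
  \<open>x\<close>.\<close>

lemma exp_minus_quadratic_bound:
  fixes x :: real
  assumes "x \<ge> 0"
  shows "\<bar>1 - x - exp (- x)\<bar> \<le> x\<^sup>2 / 2"
proof -
  have "1 - x \<le> exp (- x)" using exp_ge_add_one_self[of "-x"] by simp
  moreover have "exp (- x) \<le> 1 - x + x\<^sup>2 / 2"
  proof -
    have "(1 - x + x\<^sup>2 / 2) * (1 + x + x\<^sup>2 / 2) = 1 + (x\<^sup>2)\<^sup>2 / 4"
      by (simp add: algebra_simps power2_eq_square)
    then have "1 \<le> (1 - x + x\<^sup>2 / 2) * (1 + x + x\<^sup>2 / 2)" by simp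
    also have "\<dots> \<le> (1 - x + x\<^sup>2 / 2) * exp x"
    proof (rule mult_left_mono[OF exp_lower_Taylor_quadratic[OF assms]])
      have "0 \<le> (1 - x)\<^sup>2" by simp
      then show "0 \<le> 1 - x + x\<^sup>2 / 2" by (simp add: power2_diff)
    qed
    finally show ?thesis by (simp add: exp_minus field_simps)
  qed
  ultimately show ?thesis by simp
qed

lemma (in real_distribution) unit_interval_integrable:
  assumes "AE x in M. x \<in> {0..1}"
  shows "integrable M (\<lambda>x. x)" "integrable M (\<lambda>x. (x - c)\<^sup>2)"
proof -
  show "integrable M (\<lambda>x. x)"
    by (rule integrable_const_bound[where B = 1]) (use assms in auto)
  show "integrable M (\<lambda>x. (x - c)\<^sup>2)"
  proof (rule integrable_const_bound[where B = "(1 + \<bar>c\<bar>)\<^sup>2"])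
    show "AE x in M. norm ((x - c)\<^sup>2) \<le> (1 + \<bar>c\<bar>)\<^sup>2"
      using assms
    proof eventually_elim
      case (elim x)
      then have "\<bar>x - c\<bar> \<le> \<bar>1 + \<bar>c\<bar>\<bar>" by auto
      then have "(x - c)\<^sup>2 \<le> (1 + \<bar>c\<bar>)\<^sup>2" by (rule abs_le_square_iff[THEN iffD1])
      then show ?case by simp
    qed
  qed simp
qed

text \<open>Values in [0,1] give \<open>\<bar>x - m\<bar> \<le> 1\<close>, so the third absolute
  central moment and \<open>v\<close> are at most 1. The cubic term is the Taylor remainder of the
  characteristic function; the quartic one is \<open>exp_minus_quadratic_bound\<close> at
  \<open>s\<^sup>2 * v / 2\<close>. Neither depends on the law.\<close>

lemma (in real_distribution) char_centred_approx:
  assumes AE: "AE x in M. x \<in> {0..1}"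
  defines "m \<equiv> \<integral>x. x \<partial>M"
  defines "v \<equiv> \<integral>x. (x - m)\<^sup>2 \<partial>M"
  shows "norm (char (distr M borel (\<lambda>x. x - m)) s - exp (- (s\<^sup>2 * v / 2))) \<le> \<bar>s\<bar> ^ 3 / 6 + s ^ 4 / 8"
    and "0 \<le> v"
proof -
  note int = unit_interval_integrable[OF AE]
  have m: "0 \<le> m" "m \<le> 1"
    unfolding m_def using AE
    by (auto intro!: integral_ge_const[OF int(1)] integral_le_const[OF int(1)])
  have b: "AE x in M. \<bar>x - m\<bar> \<le> 1" using AE by eventually_elim (use m in auto)
  show v0: "0 \<le> v" unfolding v_def by simp
  have v1: "v \<le> 1" unfolding v_def
    by (rule integral_le_const[OF int(2)], use b in eventually_elim) (simp add: abs_square_le_1)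
  have e0: "expectation (\<lambda>x. x - m) = 0" using int(1) prob_space by (simp add: m_def)
  have "cmod (char (distr M borel (\<lambda>x. x - m)) s - (1 - s\<^sup>2 * v / 2))
      \<le> s\<^sup>2 / 6 * expectation (\<lambda>x. min (6 * (x - m)\<^sup>2) (\<bar>s\<bar> * \<bar>x - m\<bar> ^ 3))"
  proof (rule char_approx3'[where X = "\<lambda>x. x - m"])
    show "integrable M (\<lambda>x. x - m)" using int(1) by simp
    show "integrable M (\<lambda>x. (x - m)\<^sup>2)" by (rule int(2))
    show "variance (\<lambda>x. x - m) = v" unfolding e0 v_def by simp
  qed (use e0 in simp_all)
  also have "expectation (\<lambda>x. min (6 * (x - m)\<^sup>2) (\<bar>s\<bar> * \<bar>x - m\<bar> ^ 3)) \<le> \<bar>s\<bar>"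
  proof (rule integral_le_const)
    show "integrable M (\<lambda>x. min (6 * (x - m)\<^sup>2) (\<bar>s\<bar> * \<bar>x - m\<bar> ^ 3))"
      by (rule Bochner_Integration.integrable_bound[OF integrable_mult_right[OF int(2)[of m], of 6]]) auto
    show "AE x in M. min (6 * (x - m)\<^sup>2) (\<bar>s\<bar> * \<bar>x - m\<bar> ^ 3) \<le> \<bar>s\<bar>"
      using b
    proof eventually_elim
      case (elim x)
      then have "\<bar>x - m\<bar> ^ 3 \<le> 1" by (simp add: power_le_one)
      then have "\<bar>s\<bar> * \<bar>x - m\<bar> ^ 3 \<le> \<bar>s\<bar>" by (rule mult_left_le) simp
      then show ?case by simp
    qed
  qed
  finally have 1: "cmod (char (distr M borel (\<lambda>x. x - m)) s - (1 - s\<^sup>2 * v / 2)) \<le> s\<^sup>2 / 6 * \<bar>s\<bar>"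
    by (simp add: mult_left_mono)
  have "cmod ((1 - s\<^sup>2 * v / 2) - exp (- (s\<^sup>2 * v / 2))) = \<bar>1 - s\<^sup>2 * v / 2 - exp (- (s\<^sup>2 * v / 2))\<bar>"
    by (subst norm_of_real[symmetric, where 'a = complex]) (simp add: exp_of_real)
  also have "\<dots> \<le> (s\<^sup>2 * v / 2)\<^sup>2 / 2"
    using v0 by (intro exp_minus_quadratic_bound) simp
  also have "\<dots> \<le> (s\<^sup>2 / 2)\<^sup>2 / 2"
    using v0 v1 by (intro divide_right_mono power_mono) (auto intro!: mult_left_le)
  finally have 2: "cmod ((1 - s\<^sup>2 * v / 2) - exp (- (s\<^sup>2 * v / 2))) \<le> s ^ 4 / 8"
    by (simp add: power_divide power_mult[symmetric])
  show "norm (char (distr M borel (\<lambda>x. x - m)) s - exp (- (s\<^sup>2 * v / 2))) \<le> \<bar>s\<bar> ^ 3 / 6 + s ^ 4 / 8"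
    using norm_triangle_mono[OF 1 2] by (simp add: power2_eq_square power3_eq_cube abs_mult)
qed

text \<open>With s = t / sqrt n both sides are n-th powers of numbers of modulus at most 1, and such
  powers differ by at most n times the difference of the bases. Multiplying the one-variable error
  by n leaves the orders 1 / sqrt n and 1 / n.\<close>

lemma (in prob_space) char_iid_sum_approx:
  assumes indep: "indep_vars (\<lambda>_. borel) Y {1..n}"
    and law: "\<And>i. i \<in> {1..n} \<Longrightarrow> distr M borel (Y i) = \<nu>"
    and \<nu>: "real_distribution \<nu>" and AE: "AE x in \<nu>. x \<in> {0..1}" and n: "n > 0"
  defines "m \<equiv> \<integral>x. x \<partial>\<nu>"
  defines "v \<equiv> \<integral>x. (x - m)\<^sup>2 \<partial>\<nu>"
  shows "norm (char (distr M borel (\<lambda>\<omega>. (\<Sum>i=1..n. Y i \<omega> - m) / sqrt (real n))) t - exp (- (t\<^sup>2 * v / 2)))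
    \<le> \<bar>t\<bar> ^ 3 / 6 / sqrt (real n) + t ^ 4 / 8 / real n"
proof -
  interpret \<nu>: real_distribution \<nu> by fact
  interpret c: real_distribution "distr \<nu> borel (\<lambda>x. x - m)"
    by (rule \<nu>.real_distribution_distr) simp
  define s where "s = t / sqrt (real n)"
  have rv: "Y i \<in> borel_measurable M" if "i \<in> {1..n}" for i
    using indep that by (simp add: indep_vars_def2)
  have "char (distr M borel (\<lambda>\<omega>. (\<Sum>i=1..n. Y i \<omega> - m) / sqrt (real n))) t
      = char (distr M borel (\<lambda>\<omega>. (\<Sum>i=1..n. (Y i \<omega> - m) / sqrt (real n)))) t"
    by (simp only: sum_divide_distrib)
  also have "\<dots> = (\<Prod>i=1..n. char (distr M borel (\<lambda>\<omega>. (Y i \<omega> - m) / sqrt (real n))) t)"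
    by (rule char_distr_sum, rule indep_vars_compose2[OF indep]) simp
  also have "\<dots> = (\<Prod>i=1..n. char (distr \<nu> borel (\<lambda>x. x - m)) s)"
  proof (rule prod.cong[OF refl])
    fix i assume i: "i \<in> {1..n}"
    note rv[OF i, measurable]
    show "char (distr M borel (\<lambda>\<omega>. (Y i \<omega> - m) / sqrt (real n))) t = char (distr \<nu> borel (\<lambda>x. x - m)) s"
      unfolding law[OF i, symmetric] char_def by (simp add: integral_distr s_def)
  qed
  also have "\<dots> = char (distr \<nu> borel (\<lambda>x. x - m)) s ^ n" by simp
  finally have char_eq: "char (distr M borel (\<lambda>\<omega>. (\<Sum>i=1..n. Y i \<omega> - m) / sqrt (real n))) t
      = char (distr \<nu> borel (\<lambda>x. x - m)) s ^ n" .
  have "t\<^sup>2 = real n * s\<^sup>2" using n by (simp add: s_def power_divide)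
  then have exp_eq: "complex_of_real (exp (- (t\<^sup>2 * v / 2))) = complex_of_real (exp (- (s\<^sup>2 * v / 2))) ^ n"
    by (simp add: exp_of_nat_mult[symmetric] mult_ac flip: of_real_power)
  note approx = \<nu>.char_centred_approx(1)[OF AE, of s, folded m_def, folded v_def]
    \<nu>.char_centred_approx(2)[OF AE, folded m_def, folded v_def]
  have "norm (char (distr \<nu> borel (\<lambda>x. x - m)) s ^ n - complex_of_real (exp (- (s\<^sup>2 * v / 2))) ^ n)
      \<le> real n * norm (char (distr \<nu> borel (\<lambda>x. x - m)) s - complex_of_real (exp (- (s\<^sup>2 * v / 2))))"
    by (rule norm_power_diff) (use approx(2) c.cmod_char_le_1 in auto)
  also have "\<dots> \<le> real n * (\<bar>s\<bar> ^ 3 / 6 + s ^ 4 / 8)"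
    using approx(1) by (intro mult_left_mono) auto
  also have "\<dots> = \<bar>t\<bar> ^ 3 / 6 / sqrt (real n) + t ^ 4 / 8 / real n"
  proof -
    have r: "sqrt (real n) ^ 2 = real n" "sqrt (real n) > 0" using n by auto
    have r4: "sqrt (real n) ^ 4 = real n * real n"
      using r(1) by (simp add: power4_eq_xxxx power2_eq_square)
    have "real n * (\<bar>s\<bar> ^ 3 / 6) = \<bar>t\<bar> ^ 3 / 6 / sqrt (real n)"
      unfolding s_def abs_divide power_divide using r
      by (simp add: power3_eq_cube power2_eq_square field_simps)
    moreover have "real n * (s ^ 4 / 8) = t ^ 4 / 8 / real n"
      unfolding s_def power_divide r4 using n by simp
    ultimately show ?thesis by (simp only: distrib_left)
  qed
  finally show ?thesis unfolding char_eq exp_eq .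
qed

text \<open>Each row is first compared with the Gaussian of its own variance, with an error free of
  \<open>\<nu> k\<close>; only then does the variance move to \<open>v\<close>. Levy's continuity
  theorem converts this into weak convergence.\<close>

lemma clt_triangular_bounded_iid:
  fixes M :: "nat \<Rightarrow> 'a measure" and Y :: "nat \<Rightarrow> nat \<Rightarrow> 'a \<Rightarrow> real"
  assumes M: "\<And>k. prob_space (M k)"
    and indep: "\<And>k. prob_space.indep_vars (M k) (\<lambda>_. borel) (Y k) {1..n k}"
    and law: "\<And>k i. i \<in> {1..n k} \<Longrightarrow> distr (M k) borel (Y k i) = \<nu> k"
    and \<nu>: "\<And>k. real_distribution (\<nu> k)" and AE: "\<And>k. AE x in \<nu> k. x \<in> {0..1}"
    and n: "filterlim n at_top sequentially"
    and m: "\<And>k. m k = (\<integral>x. x \<partial>\<nu> k)"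
    and v: "(\<lambda>k. \<integral>x. (x - m k)\<^sup>2 \<partial>\<nu> k) \<longlonglongrightarrow> v"
  shows "weak_conv_m (\<lambda>k. distr (M k) borel (\<lambda>\<omega>. (\<Sum>i=1..n k. Y k i \<omega> - m k) / sqrt (real (n k))))
    (normal_law 0 v)"
proof -
  have v0: "v \<ge> 0" by (rule LIMSEQ_le_const[OF v]) auto
  have rv: "Y k i \<in> borel_measurable (M k)" if "i \<in> {1..n k}" for k i
    using indep[of k] that by (simp add: prob_space.indep_vars_def2[OF M])
  show ?thesis
  proof (rule levy_continuity)
    show "real_distribution (distr (M k) borel (\<lambda>\<omega>. (\<Sum>i=1..n k. Y k i \<omega> - m k) / sqrt (real (n k))))" for k
      by (rule prob_space.real_distribution_distr[OF M]) (use rv in measurable)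
    show "real_distribution (normal_law 0 v)" by (rule real_distribution_normal_law[OF v0])
    fix t
    have bound: "(\<lambda>k. \<bar>t\<bar> ^ 3 / 6 / sqrt (real (n k)) + t ^ 4 / 8 / real (n k)) \<longlonglongrightarrow> 0"
    proof -
      have r: "filterlim (\<lambda>k. real (n k)) at_top sequentially"
        using n by (rule filterlim_compose[OF filterlim_real_sequentially])
      have "(\<lambda>k. \<bar>t\<bar> ^ 3 / 6 / sqrt (real (n k))) \<longlonglongrightarrow> 0" "(\<lambda>k. t ^ 4 / 8 / real (n k)) \<longlonglongrightarrow> 0"
        by (rule tendsto_divide_0[OF tendsto_const] filterlim_at_top_imp_at_infinity r
            filterlim_compose[OF sqrt_at_top r])+
      then show ?thesis using tendsto_add by fastforce
    qed
    have "\<forall>\<^sub>F k in sequentially. norm (char (distr (M k) borel (\<lambda>\<omega>. (\<Sum>i=1..n k. Y k i \<omega> - m k) / sqrt (real (n k)))) t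
          - exp (- (t\<^sup>2 * (\<integral>x. (x - m k)\<^sup>2 \<partial>\<nu> k) / 2)))
        \<le> \<bar>t\<bar> ^ 3 / 6 / sqrt (real (n k)) + t ^ 4 / 8 / real (n k)"
      using eventually_compose_filterlim[OF eventually_gt_at_top[of 0] n]
    proof eventually_elim
      case (elim k)
      show ?case
        unfolding m using prob_space.char_iid_sum_approx[OF M indep law \<nu> AE elim, of t]
        by blast
    qed
    then have diff: "(\<lambda>k. char (distr (M k) borel (\<lambda>\<omega>. (\<Sum>i=1..n k. Y k i \<omega> - m k) / sqrt (real (n k)))) t
        - exp (- (t\<^sup>2 * (\<integral>x. (x - m k)\<^sup>2 \<partial>\<nu> k) / 2))) \<longlonglongrightarrow> 0"
      by (rule Lim_null_comparison[OF _ bound])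
    have "(\<lambda>k. complex_of_real (exp (- (t\<^sup>2 * (\<integral>x. (x - m k)\<^sup>2 \<partial>\<nu> k) / 2)))) \<longlonglongrightarrow> exp (- (t\<^sup>2 * v / 2))"
      by (intro tendsto_intros v) simp
    from tendsto_add[OF diff this]
    show "(\<lambda>k. char (distr (M k) borel (\<lambda>\<omega>. (\<Sum>i=1..n k. Y k i \<omega> - m k) / sqrt (real (n k)))) t)
        \<longlonglongrightarrow> char (normal_law 0 v) t"
      by (simp add: char_normal_law[OF v0])
  qed
qed

section \<open>The delta method for quasi-arithmetic means\<close>

locale quasi_arithmetic_mean =
  fixes I :: "real set" and G :: "real \<Rightarrow> real"
  assumes interval: "is_interval I"
    and G_fun: "G \<in> I \<rightarrow>\<^sub>E {0<..<1}"
    and G_cont: "continuous_on I G"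
    and G_mono: "strict_mono_on I G"
    and G_bij: "bij_betw G I {0<..<1}"
begin

abbreviation H :: "real \<Rightarrow> real" where "H \<equiv> the_inv_into I G"

lemma G_inj: "inj_on G I"
  using G_bij by (rule bij_betw_imp_inj_on)

lemma G_range: "x \<in> I \<Longrightarrow> 0 < G x \<and> G x < 1"
  using G_fun by auto

lemma G_less: "x \<in> I \<Longrightarrow> y \<in> I \<Longrightarrow> x < y \<Longrightarrow> G x < G y"
  using G_mono by (simp add: strict_mono_on_def)

lemma H_in: "0 < u \<Longrightarrow> u < 1 \<Longrightarrow> H u \<in> I"
  using G_bij by (intro the_inv_into_into[OF G_inj]) (auto simp: bij_betw_def)

lemma G_H: "0 < u \<Longrightarrow> u < 1 \<Longrightarrow> G (H u) = u"
  using G_bij by (intro f_the_inv_into_f[OF G_inj]) (auto simp: bij_betw_def)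

lemma H_G: "x \<in> I \<Longrightarrow> H (G x) = x"
  by (rule the_inv_into_f_f[OF G_inj])

text \<open>These comparisons stand in for monotonicity and continuity of the inverse: they yield
  its measurability on (0,1) and the squeeze in \<open>H_tendsto\<close>.\<close>

lemma H_less_iff:
  assumes "0 < u" "u < 1" "x \<in> I"
  shows "H u < x \<longleftrightarrow> u < G x" "x < H u \<longleftrightarrow> G x < u"
  using G_less[OF assms(3) H_in[OF assms(1,2)]] G_less[OF H_in[OF assms(1,2)] assms(3)]
    G_H[OF assms(1,2)] by (metis linorder_neqE_linordered_idom order_less_asym)+

text \<open>Outside \<open>(0, 1)\<close> the inverse is a constant junk value, so it is measurable everywhere.\<close>

lemma H_outside: "\<not> (0 < u \<and> u < 1) \<Longrightarrow> H u = (THE x. False)"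
  unfolding the_inv_into_def using G_range by (intro arg_cong[where f = The] ext) auto

lemma H_measurable [measurable]: "H \<in> borel_measurable borel"
proof -
  have "mono_on {0<..<1} H"
    by (rule mono_onI) (metis H_less_iff(1) G_H H_in greaterThanLessThan_iff not_le)
  then have "H \<in> borel_measurable (restrict_space borel {0<..<1})"
    by (rule borel_measurable_mono_on_fnc)
  then have "(\<lambda>u. if u \<in> {0<..<1} then H u else (THE x. False)) \<in> borel_measurable borel"
    by (subst measurable_If_restrict_space_iff) (auto simp: greaterThanLessThan_eq lessThan_def greaterThan_def Int_def)
  also have "(\<lambda>u. if u \<in> {0<..<1} then H u else (THE x. False)) = H"
    using H_outside by auto
  finally show ?thesis .
qed

text \<open>\<open>G\<close> is extensional, that is constantly \<open>undefined\<close> off the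
  Borel set \<open>I\<close>, so continuity on \<open>I\<close> gives measurability on the whole
  line.\<close>

lemma G_measurable [measurable]: "G \<in> borel_measurable borel"
proof -
  have "I \<in> sets borel" using interval by (rule real_interval_borel_measurable)
  then have "(\<lambda>x. if x \<in> I then G x else undefined) \<in> borel_measurable borel"
    by (rule borel_measurable_continuous_on_if[OF _ G_cont]) simp
  also have "(\<lambda>x. if x \<in> I then G x else undefined) = G"
    using G_fun by (auto simp: PiE_def extensional_def)
  finally show ?thesis .
qed

lemma gmean_measurable [measurable (raw)]:
  assumes "\<And>i. i \<in> {1..n} \<Longrightarrow> (\<lambda>\<omega>. x \<omega> i) \<in> borel_measurable M"
  shows "(\<lambda>\<omega>. gmean I G n (x \<omega>)) \<in> borel_measurable M"
proof -
  have "(\<lambda>\<omega>. (\<Sum>i=1..n. G (x \<omega> i)) / real n) \<in> borel_measurable M"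
    by (intro borel_measurable_divide borel_measurable_sum measurable_compose[OF assms G_measurable]) auto
  then show ?thesis unfolding gmean_def by (rule measurable_compose) measurable
qed

end

section \<open>Local behaviour of the inverse near the population mean\<close>

locale smooth_quasi_arithmetic_mean = quasi_arithmetic_mean +
  fixes b :: real and U :: "real set"
  assumes U: "open U" "b \<in> U" "U \<subseteq> I"
    and G_diff: "\<And>x. x \<in> U \<Longrightarrow> G field_differentiable (at x)"
    and G'_cont: "continuous_on U (deriv G)"
    and G'_pos: "deriv G b > 0"
begin

text \<open>For small \<open>r\<close> the points \<open>b - r\<close> and \<open>b + r\<close> lie
  in \<open>I\<close>, so eventually \<open>u k\<close> lies between their images under
  \<open>G\<close>. This traps \<open>H (u k)\<close> within \<open>r\<close> of \<open>b\<close>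
  and also places \<open>u k\<close> inside (0,1), away from the junk values of
  \<open>H\<close>.\<close>

lemma H_tendsto:
  assumes "u \<longlonglongrightarrow> G b" shows "(\<lambda>k. H (u k)) \<longlonglongrightarrow> b"
proof (rule tendstoI)
  fix e :: real assume e: "e > 0"
  obtain r0 where r0: "r0 > 0" "cball b r0 \<subseteq> U"
    using U(1,2) by (meson open_contains_cball)
  define r where "r = min r0 (e / 2)"
  have r: "0 < r" "r < e" "r \<le> r0" using r0 e by (auto simp: r_def)
  have "b - r \<in> cball b r0" "b + r \<in> cball b r0" using r by (simp_all add: dist_real_def)
  then have in_I: "b - r \<in> I" "b + r \<in> I" "b \<in> I" using r0(2) U by blast+
  then have less: "G (b - r) < G b" "G b < G (b + r)" using r(1) by (auto intro: G_less)
  have "\<forall>\<^sub>F k in sequentially. G (b - r) < u k" "\<forall>\<^sub>F k in sequentially. u k < G (b + r)"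
    using order_tendstoD[OF assms] less by auto
  then show "\<forall>\<^sub>F k in sequentially. dist (H (u k)) b < e"
  proof eventually_elim
    case (elim k)
    have "0 < u k" "u k < 1" using elim G_range[OF in_I(1)] G_range[OF in_I(2)] by auto
    then have "b - r < H (u k)" "H (u k) < b + r" using H_less_iff in_I elim by auto
    then show ?case using r(2) by (simp add: dist_real_def)
  qed
qed

lemma delta_method:
  fixes n :: "nat \<Rightarrow> nat"
  assumes n: "filterlim n at_top sequentially" and m: "m \<longlonglongrightarrow> G b" and s: "s \<longlonglongrightarrow> s0"
  shows "(\<lambda>k. sqrt (real (n k)) * (H (m k + s k / sqrt (real (n k))) - H (m k))) \<longlonglongrightarrow> s0 / deriv G b"
proof -
  define u where "u k = m k + s k / sqrt (real (n k))" for k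
  define a where "a k = H (u k)" for k
  define c where "c k = H (m k)" for k
  have "filterlim (\<lambda>k. sqrt (real (n k))) at_infinity sequentially"
    using n by (intro filterlim_at_top_imp_at_infinity filterlim_compose[OF sqrt_at_top]
        filterlim_compose[OF filterlim_real_sequentially])
  from tendsto_add[OF m tendsto_divide_0[OF s this]] have u: "u \<longlonglongrightarrow> G b"
    by (simp add: u_def[abs_def])
  have a: "a \<longlonglongrightarrow> b" and c: "c \<longlonglongrightarrow> b"
    using H_tendsto[OF u] H_tendsto[OF m] by (auto simp: a_def[abs_def] c_def[abs_def])
  obtain r where r: "r > 0" "ball b r \<subseteq> U" using U(1,2) by (meson open_contains_ball)
  have der: "(G has_field_derivative deriv G x) (at x)" if "x \<in> ball b r" for x
    using G_diff r(2) that by (auto simp: DERIV_deriv_iff_field_differentiable)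
  have mvt_less: "\<exists>\<xi>. x < \<xi> \<and> \<xi> < y \<and> G y - G x = (y - x) * deriv G \<xi>"
    if "x \<in> ball b r" "y \<in> ball b r" "x < y" for x y
    by (rule MVT2[OF that(3)], rule der) (use that in \<open>auto simp: dist_real_def\<close>)
  \<comment> \<open>The sum on the right bounds the distance from \<open>b\<close> of any point
    between \<open>x\<close> and \<open>y\<close>, whichever is larger, and allows
    \<open>\<xi> = x\<close> when they coincide. It is enough to force the intermediate points to
    \<open>b\<close>.\<close>
  have mvt: "\<exists>\<xi>. \<bar>\<xi> - b\<bar> \<le> \<bar>x - b\<bar> + \<bar>y - b\<bar> \<and> G x - G y = (x - y) * deriv G \<xi>"
    if xy: "x \<in> ball b r" "y \<in> ball b r" for x y
  proof (cases x y rule: linorder_cases)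
    case less
    with mvt_less[OF xy] obtain \<xi> where "x < \<xi>" "\<xi> < y" "G y - G x = (y - x) * deriv G \<xi>" by blast
    then show ?thesis by (intro exI[of _ \<xi>]) (auto simp: algebra_simps)
  next
    case equal then show ?thesis by (intro exI[of _ x]) auto
  next
    case greater
    with mvt_less[OF xy(2,1)] obtain \<xi> where "y < \<xi>" "\<xi> < x" "G x - G y = (x - y) * deriv G \<xi>" by blast
    then show ?thesis by (intro exI[of _ \<xi>]) auto
  qed
  have "\<exists>\<xi>. \<forall>k. a k \<in> ball b r \<and> c k \<in> ball b r \<longrightarrow>
      \<bar>\<xi> k - b\<bar> \<le> \<bar>a k - b\<bar> + \<bar>c k - b\<bar> \<and> G (a k) - G (c k) = (a k - c k) * deriv G (\<xi> k)"
    by (rule choice) (use mvt in blast)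
  then obtain \<xi> where \<xi>: "\<And>k. a k \<in> ball b r \<Longrightarrow> c k \<in> ball b r \<Longrightarrow>
      \<bar>\<xi> k - b\<bar> \<le> \<bar>a k - b\<bar> + \<bar>c k - b\<bar> \<and> G (a k) - G (c k) = (a k - c k) * deriv G (\<xi> k)" by blast
  have ev: "\<forall>\<^sub>F k in sequentially. a k \<in> ball b r \<and> c k \<in> ball b r"
    using tendstoD[OF a r(1)] tendstoD[OF c r(1)]
    by eventually_elim (simp add: dist_commute)
  have "\<xi> \<longlonglongrightarrow> b"
  proof (rule Lim_transform2[OF tendsto_const], rule Lim_null_comparison)
    show "\<forall>\<^sub>F k in sequentially. norm (b - \<xi> k) \<le> \<bar>a k - b\<bar> + \<bar>c k - b\<bar>"
      using ev by eventually_elim (use \<xi> in \<open>auto simp: abs_minus_commute\<close>)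
    show "(\<lambda>k. \<bar>a k - b\<bar> + \<bar>c k - b\<bar>) \<longlonglongrightarrow> 0"
      using tendsto_add[OF tendsto_rabs_zero[OF LIM_zero[OF a]] tendsto_rabs_zero[OF LIM_zero[OF c]]]
      by simp
  qed
  moreover have "isCont (deriv G) b"
    using G'_cont U(1,2) by (simp add: continuous_on_eq_continuous_at)
  ultimately have G'\<xi>: "(\<lambda>k. deriv G (\<xi> k)) \<longlonglongrightarrow> deriv G b"
    by (rule isCont_tendsto_compose[rotated])
  have Gb: "0 < G b" "G b < 1" using G_range U by auto
  \<comment> \<open>The identity holds only eventually: both points must be in the ball for the mean
    value theorem, \<open>u k\<close> and \<open>m k\<close> in (0,1) for \<open>G\<close> to undo
    \<open>H\<close>, and \<open>n k\<close> positive for the rescaling.\<close>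
  have "\<forall>\<^sub>F k in sequentially. s k / deriv G (\<xi> k) = sqrt (real (n k)) * (a k - c k)"
    using ev order_tendstoD(1)[OF G'\<xi> G'_pos] order_tendstoD(1)[OF u Gb(1)] order_tendstoD(2)[OF u Gb(2)]
      order_tendstoD(1)[OF m Gb(1)] order_tendstoD(2)[OF m Gb(2)]
      eventually_compose_filterlim[OF eventually_gt_at_top[of 0] n]
  proof eventually_elim
    case (elim k)
    then have "u k - m k = (a k - c k) * deriv G (\<xi> k)"
      using \<xi>[of k] by (auto simp: a_def c_def G_H)
    then have "s k / sqrt (real (n k)) = (a k - c k) * deriv G (\<xi> k)"
      by (simp add: u_def)
    then show ?case using elim by (simp add: field_simps)
  qed
  moreover have "(\<lambda>k. s k / deriv G (\<xi> k)) \<longlonglongrightarrow> s0 / deriv G b"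
    using G'_pos by (intro tendsto_divide s G'\<xi>) auto
  ultimately show ?thesis
    unfolding a_def c_def u_def by (rule Lim_transform_eventually[rotated])
qed

text \<open>The row law \<open>\<nu> k\<close> and its mean may vary, so that one statement serves
  both the bootstrap, with empirical row laws, and the original sample, with a constant one.\<close>

lemma quasi_mean_root_clt:
  fixes M :: "nat \<Rightarrow> 'a measure" and Y :: "nat \<Rightarrow> nat \<Rightarrow> 'a \<Rightarrow> real"
  assumes M: "\<And>k. prob_space (M k)"
    and indep: "\<And>k. prob_space.indep_vars (M k) (\<lambda>_. borel) (Y k) {1..n k}"
    and law: "\<And>k i. i \<in> {1..n k} \<Longrightarrow> distr (M k) borel (Y k i) = \<nu> k"
    and \<nu>: "\<And>k. real_distribution (\<nu> k)" and AE: "\<And>k. AE x in \<nu> k. x \<in> {0..1}"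
    and n: "filterlim n at_top sequentially"
    and m: "\<And>k. m k = (\<integral>x. x \<partial>\<nu> k)" "m \<longlonglongrightarrow> G b"
    and v: "(\<lambda>k. \<integral>x. (x - m k)\<^sup>2 \<partial>\<nu> k) \<longlonglongrightarrow> v"
  shows "(\<lambda>k. bl_dist (distr (M k) borel (\<lambda>\<omega>. sqrt (real (n k)) * (H ((\<Sum>i=1..n k. Y k i \<omega>) / real (n k)) - H (m k))))
    (normal_law 0 (v / (deriv G b)\<^sup>2))) \<longlonglongrightarrow> 0"
proof -
  define S where "S k \<omega> = (\<Sum>i=1..n k. Y k i \<omega> - m k) / sqrt (real (n k))" for k \<omega>
  define f where "f k s = sqrt (real (n k)) * (H (m k + s / sqrt (real (n k))) - H (m k))" for k s
  have v0: "v \<ge> 0" by (rule LIMSEQ_le_const[OF v]) auto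
  have rv: "Y k i \<in> borel_measurable (M k)" if "i \<in> {1..n k}" for k i
    using indep[of k] that by (simp add: prob_space.indep_vars_def2[OF M])
  have S_meas[measurable]: "S k \<in> borel_measurable (M k)" for k
    unfolding S_def using rv by measurable
  have weak: "weak_conv_m (\<lambda>k. distr (M k) borel (S k)) (normal_law 0 v)"
    unfolding S_def[abs_def] by (rule clt_triangular_bounded_iid[OF M indep law \<nu> AE n m(1) v])
  have f_meas[measurable]: "f k \<in> borel_measurable borel" for k
    unfolding f_def by measurable
  have "(\<lambda>k. bl_dist (distr (distr (M k) borel (S k)) borel (f k))
      (distr (normal_law 0 v) borel (\<lambda>s. (1 / deriv G b) * s))) \<longlonglongrightarrow> 0"
  proof (rule bl_dist_extended_continuous_mapping[OF _ real_distribution_normal_law[OF v0] weak])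
    show "real_distribution (distr (M k) borel (S k))" for k
      by (rule prob_space.real_distribution_distr[OF M]) simp
    show "(\<lambda>k. f k (s k)) \<longlonglongrightarrow> (1 / deriv G b) * s0" if "s \<longlonglongrightarrow> s0" for s s0
      using delta_method[OF n m(2) that] by (simp add: f_def)
  qed auto
  moreover have "distr (normal_law 0 v) borel (\<lambda>s. (1 / deriv G b) * s) = normal_law 0 (v / (deriv G b)\<^sup>2)"
    using G'_pos by (subst distr_normal_law_scale[OF v0]) (auto simp: power_divide)
  moreover have "distr (distr (M k) borel (S k)) borel (f k)
      = distr (M k) borel (\<lambda>\<omega>. sqrt (real (n k)) * (H ((\<Sum>i=1..n k. Y k i \<omega>) / real (n k)) - H (m k)))" for k
  proof -
    have "f k (S k \<omega>) = sqrt (real (n k)) * (H ((\<Sum>i=1..n k. Y k i \<omega>) / real (n k)) - H (m k))" for \<omega>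
    \<comment> \<open>An empty row is harmless: the factor \<open>sqrt 0\<close> makes both sides
      0.\<close>
    proof (cases "n k = 0")
      case False
      then have "m k + S k \<omega> / sqrt (real (n k)) = (\<Sum>i=1..n k. Y k i \<omega>) / real (n k)"
        by (simp add: S_def sum_subtractf field_simps)
      then show ?thesis by (simp add: f_def)
    qed (simp add: f_def)
    then show ?thesis by (simp add: distr_distr comp_def)
  qed
  ultimately show ?thesis by simp
qed

end

section \<open>The bootstrap\<close>

text \<open>Hoeffding's inequality for variables in an interval of length 1 gives a geometrically
  decaying tail bound.\<close>

lemma (in prob_space) weak_law_bounded_iid:
  assumes indep: "indep_vars (\<lambda>_. borel) Y {1..}"
    and law: "\<And>i. i \<ge> 1 \<Longrightarrow> distr M borel (Y i) = distr M borel Z"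
    and Z: "Z \<in> borel_measurable M" and AE: "AE \<omega> in M. Z \<omega> \<in> {0..1::real}"
    and e: "\<epsilon> > 0"
  shows "(\<lambda>n. prob {\<omega>\<in>space M. \<bar>(\<Sum>i=1..n. Y i \<omega>) / real n - expectation Z\<bar> \<ge> \<epsilon>}) \<longlonglongrightarrow> 0"
proof (rule Lim_null_comparison)
  show "\<forall>\<^sub>F n in sequentially. norm (prob {\<omega>\<in>space M. \<bar>(\<Sum>i=1..n. Y i \<omega>) / real n - expectation Z\<bar> \<ge> \<epsilon>})
      \<le> 2 * exp (-2 * real n * \<epsilon>\<^sup>2)"
    using eventually_gt_at_top[of 0]
  proof eventually_elim
    case (elim n)
    interpret Hoeffding_ineq_iid M "{1..n}" Y Z 0 1 "expectation Z"
    proof unfold_locales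
      show "indep_vars (\<lambda>_. borel) Y {1..n}" by (rule indep_vars_subset[OF indep]) auto
    qed (use law Z AE in auto)
    show ?case using Hoeffding_ineq_abs_ge'[of \<epsilon>] e elim by simp
  qed
  show "(\<lambda>n. 2 * exp (-2 * real n * \<epsilon>\<^sup>2)) \<longlonglongrightarrow> 0"
  proof -
    have "(\<lambda>n. 2 * exp (-2 * \<epsilon>\<^sup>2) ^ n) \<longlonglongrightarrow> 0"
      using e by (intro tendsto_mult_right_zero LIMSEQ_power_zero) simp
    then show ?thesis by (simp add: exp_of_nat_mult[symmetric] mult_ac)
  qed
qed

text \<open>Resampling positions instead of values gives a finite sample space that is the same for
  all data sets. The default 0 lies outside the sample positions.\<close>

definition index_draws :: "nat \<Rightarrow> (nat \<Rightarrow> nat) set" where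
  "index_draws n = PiE_dflt {1..n} 0 (\<lambda>_. {1..n})"

lemma index_draws_range: "f \<in> index_draws n \<Longrightarrow> i \<in> {1..n} \<Longrightarrow> f i \<in> {1..n}"
  by (auto simp: index_draws_def PiE_dflt_def)

lemma index_draws_finite: "finite (index_draws n)"
  unfolding index_draws_def by (rule finite_PiE_dflt) auto

lemma index_draws_nonempty: "n > 0 \<Longrightarrow> index_draws n \<noteq> {}"
  unfolding index_draws_def by (subst PiE_dflt_empty_iff) auto

text \<open>Index 0 is outside the sample, so resetting \<open>x 0\<close> to the dummy value changes nothing,
  and lets the dummy coordinates be pushed forward along with the others.\<close>

lemma resample_pmf_conv_index_draws:
  assumes "n > 0"
  shows "resample_pmf n x = map_pmf (\<lambda>f. x(0 := 0) \<circ> f) (pmf_of_set (index_draws n))"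
proof -
  have "empirical_pmf n x = map_pmf (x(0 := 0)) (pmf_of_set {1..n})"
    unfolding empirical_pmf_def using assms by (intro map_pmf_cong) auto
  then show ?thesis
    unfolding resample_pmf_def index_draws_def using assms
    by (simp add: Pi_pmf_map[where dflt = 0] Pi_pmf_of_set)
qed

lemma resample_component_law:
  assumes "i \<in> {1..n}"
  shows "distr (measure_pmf (resample_pmf n x)) borel (\<lambda>y. g (y i))
    = distr (measure_pmf (empirical_pmf n x)) borel g"
proof -
  have "empirical_pmf n x = map_pmf (\<lambda>y. y i) (resample_pmf n x)"
    using assms by (simp add: resample_pmf_def Pi_pmf_component)
  then show ?thesis
    by (simp add: map_pmf_rep_eq distr_distr comp_def)
qed

lemma resample_indep:
  "prob_space.indep_vars (measure_pmf (resample_pmf n x)) (\<lambda>_. borel) (\<lambda>i y. g (y i)) {1..n}"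
  unfolding resample_pmf_def
  by (rule prob_space.indep_vars_compose2[OF prob_space_measure_pmf indep_vars_Pi_pmf]) auto

lemma integral_empirical:
  fixes h :: "real \<Rightarrow> real"
  assumes "n > 0" and [measurable]: "h \<in> borel_measurable borel"
  shows "(\<integral>z. h z \<partial>distr (measure_pmf (empirical_pmf n x)) borel g) = (\<Sum>i=1..n. h (g (x i))) / real n"
  using assms(1) by (subst integral_distr) (auto simp: empirical_pmf_def integral_pmf_of_set)

lemma AE_empirical:
  assumes "n > 0" "\<And>i. i \<in> {1..n} \<Longrightarrow> g (x i) \<in> A" "A \<in> sets borel"
  shows "AE z in distr (measure_pmf (empirical_pmf n x)) borel g. z \<in> A"
  using assms by (subst AE_distr_iff) (auto simp: AE_measure_pmf_iff empirical_pmf_def)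

lemma real_distribution_boot_law: "real_distribution (boot_law I G n x)"
  unfolding boot_law_def by (rule prob_space.real_distribution_distr[OF prob_space_measure_pmf]) simp

section \<open>Measurability of the conditional law in the data\<close>

context quasi_arithmetic_mean
begin

text \<open>The data enter the right-hand side only through \<open>gmean\<close>, under a sum over a
  fixed finite set; measurability in the data can be read off.\<close>

lemma integral_boot_law:
  fixes h :: "real \<Rightarrow> real"
  assumes n: "n > 0" and h: "h \<in> borel_measurable borel"
  shows "(\<integral>z. h z \<partial>boot_law I G n x) =
    (\<Sum>f\<in>index_draws n. h (sqrt (real n) * (gmean I G n (\<lambda>i. x (f i)) - gmean I G n x))) / real (card (index_draws n))"
proof -
  have "gmean I G n (x(0 := 0) \<circ> f) = gmean I G n (\<lambda>i. x (f i))" if "f \<in> index_draws n" for f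
  proof -
    have "(\<Sum>i=1..n. G ((x(0 := 0) \<circ> f) i)) = (\<Sum>i=1..n. G (x (f i)))"
    proof (rule sum.cong[OF refl])
      fix i assume "i \<in> {1..n}"
      then have "f i \<noteq> 0" using index_draws_range[OF that, of i] by simp
      then show "G ((x(0 := 0) \<circ> f) i) = G (x (f i))" by simp
    qed
    then show ?thesis by (simp only: gmean_def)
  qed
  then show ?thesis
    unfolding boot_law_def
    by (subst integral_distr) (auto simp: h resample_pmf_conv_index_draws[OF n] integral_pmf_of_set[OF
        index_draws_nonempty[OF n] index_draws_finite])
qed

lemma bl_dist_boot_law_measurable:
  assumes X: "\<And>i. i \<in> {1..n} \<Longrightarrow> X i \<in> borel_measurable M" and L: "real_distribution L"
  shows "(\<lambda>\<omega>. bl_dist (boot_law I G n (\<lambda>i. X i \<omega>)) L) \<in> borel_measurable M"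
proof (rule borel_measurable_bl_dist[OF real_distribution_boot_law L])
  fix h assume h: "h \<in> bl_functions"
  have hm: "h \<in> borel_measurable borel" using bl_functions_measurable[OF h, of "\<lambda>x. x"] by simp
  show "(\<lambda>\<omega>. \<integral>z. h z \<partial>boot_law I G n (\<lambda>i. X i \<omega>)) \<in> borel_measurable M"
  proof (cases "n = 0")
    case True
    \<comment> \<open>Without observations the factor \<open>sqrt 0\<close> makes the root
      identically 0, so its law is the point mass at 0 for all data.\<close>
    then have "(\<integral>z. h z \<partial>boot_law I G n x) = h 0" for x
      using hm unfolding boot_law_def by (subst integral_distr) auto
    then show ?thesis by simp
  next
    case False
    then have n: "n > 0" by simp
    show ?thesis
      unfolding integral_boot_law[OF n hm]
      by (intro borel_measurable_divide borel_measurable_sum bl_functions_measurable[OF h]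
          borel_measurable_times borel_measurable_diff gmean_measurable)
        (auto intro: X dest: index_draws_range)
  qed
qed

end

section \<open>Bootstrap laws for deterministic data sets\<close>

context smooth_quasi_arithmetic_mean
begin

text \<open>The row law is that of \<open>G\<close> under the empirical distribution; its variance
  is the empirical second moment minus the squared empirical mean, which explains the limit
  \<open>q - (G b)\<^sup>2\<close>.\<close>

lemma boot_law_tendsto:
  assumes n: "filterlim n at_top sequentially" and n_pos: "\<And>k. n k > 0"
    and x: "\<And>k i. i \<in> {1..n k} \<Longrightarrow> x k i \<in> I"
    and m: "(\<lambda>k. (\<Sum>i=1..n k. G (x k i)) / real (n k)) \<longlonglongrightarrow> G b"
    and q: "(\<lambda>k. (\<Sum>i=1..n k. (G (x k i))\<^sup>2) / real (n k)) \<longlonglongrightarrow> q"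
  shows "(\<lambda>k. bl_dist (boot_law I G (n k) (x k)) (normal_law 0 ((q - (G b)\<^sup>2) / (deriv G b)\<^sup>2))) \<longlonglongrightarrow> 0"
proof -
  define \<nu> where "\<nu> k = distr (measure_pmf (empirical_pmf (n k) (x k))) borel G" for k
  define m where "m k = (\<Sum>i=1..n k. G (x k i)) / real (n k)" for k
  have int_\<nu>: "(\<integral>z. h z \<partial>\<nu> k) = (\<Sum>i=1..n k. h (G (x k i))) / real (n k)"
    if "h \<in> borel_measurable borel" for h :: "real \<Rightarrow> real" and k
    unfolding \<nu>_def by (rule integral_empirical[OF n_pos that])
  have var: "(\<integral>z. (z - m k)\<^sup>2 \<partial>\<nu> k) = (\<Sum>i=1..n k. (G (x k i))\<^sup>2) / real (n k) - (m k)\<^sup>2" for k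
  proof -
    have s: "(\<Sum>i=1..n k. G (x k i)) = real (n k) * m k" using n_pos[of k] by (simp add: m_def)
    have "(\<Sum>i=1..n k. (G (x k i) - m k)\<^sup>2)
        = (\<Sum>i=1..n k. (G (x k i))\<^sup>2) - 2 * m k * (\<Sum>i=1..n k. G (x k i)) + real (n k) * (m k)\<^sup>2"
      by (simp add: power2_diff sum.distrib sum_subtractf sum_distrib_left mult_ac)
    also have "\<dots> = (\<Sum>i=1..n k. (G (x k i))\<^sup>2) - real (n k) * (m k)\<^sup>2"
      unfolding s by (simp add: power2_eq_square)
    finally show ?thesis using n_pos[of k] by (subst int_\<nu>) (auto simp: diff_divide_distrib)
  qed
  have "(\<lambda>k. bl_dist (distr (measure_pmf (resample_pmf (n k) (x k))) borel
        (\<lambda>y. sqrt (real (n k)) * (H ((\<Sum>i=1..n k. G (y i)) / real (n k)) - H (m k))))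
      (normal_law 0 ((q - (G b)\<^sup>2) / (deriv G b)\<^sup>2))) \<longlonglongrightarrow> 0"
  proof (rule quasi_mean_root_clt[where \<nu> = \<nu> and m = m, OF prob_space_measure_pmf resample_indep _ _ _ n])
    show "distr (measure_pmf (resample_pmf (n k) (x k))) borel (\<lambda>y. G (y i)) = \<nu> k" if "i \<in> {1..n k}" for k i
      unfolding \<nu>_def by (rule resample_component_law[OF that])
    show "real_distribution (\<nu> k)" for k
      unfolding \<nu>_def by (rule prob_space.real_distribution_distr[OF prob_space_measure_pmf]) simp
    show "AE z in \<nu> k. z \<in> {0..1}" for k
      unfolding \<nu>_def by (rule AE_empirical[OF n_pos]) (use x G_range in \<open>auto simp: less_imp_le\<close>)
    show "m k = (\<integral>z. z \<partial>\<nu> k)" for k by (subst int_\<nu>) (auto simp: m_def)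
    show m_lim: "m \<longlonglongrightarrow> G b" using m by (simp add: m_def[abs_def])
    show "(\<lambda>k. \<integral>z. (z - m k)\<^sup>2 \<partial>\<nu> k) \<longlonglongrightarrow> q - (G b)\<^sup>2"
      unfolding var by (intro tendsto_diff q tendsto_power m_lim)
  qed
  then show ?thesis by (simp add: boot_law_def gmean_def m_def)
qed

lemma boot_law_uniform:
  assumes e: "\<epsilon> > 0"
  obtains \<delta> N where "\<delta> > 0"
    "\<And>n x. n \<ge> N \<Longrightarrow> (\<And>i. i \<in> {1..n} \<Longrightarrow> x i \<in> I) \<Longrightarrow>
      \<bar>(\<Sum>i=1..n. G (x i)) / real n - G b\<bar> < \<delta> \<Longrightarrow> \<bar>(\<Sum>i=1..n. (G (x i))\<^sup>2) / real n - q\<bar> < \<delta> \<Longrightarrow>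
      bl_dist (boot_law I G n x) (normal_law 0 ((q - (G b)\<^sup>2) / (deriv G b)\<^sup>2)) \<le> \<epsilon>"
proof (rule ccontr)
  define D where "D n x = bl_dist (boot_law I G n x) (normal_law 0 ((q - (G b)\<^sup>2) / (deriv G b)\<^sup>2))" for n x
  assume contra: "\<not> thesis"
  have "\<exists>n x. n \<ge> Suc k \<and> (\<forall>i\<in>{1..n}. x i \<in> I) \<and> \<bar>(\<Sum>i=1..n. G (x i)) / real n - G b\<bar> < 1 / real (Suc k) \<and>
      \<bar>(\<Sum>i=1..n. (G (x i))\<^sup>2) / real n - q\<bar> < 1 / real (Suc k) \<and> D n x > \<epsilon>" for k
  proof (rule ccontr)
    assume neg: "\<not> ?thesis"
    \<comment> \<open>If level \<open>k\<close> had no counterexample, the radius 1 / (k + 1) and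
      the threshold k + 1 would already be the required witnesses. The threshold
      \<open>Suc k\<close> later gives both positivity and divergence of \<open>n\<close>.\<close>
    have "thesis"
    proof (rule that[of "1 / real (Suc k)" "Suc k"])
      fix n x
      assume *: "n \<ge> Suc k" "\<And>i. i \<in> {1..n} \<Longrightarrow> x i \<in> I"
        "\<bar>(\<Sum>i=1..n. G (x i)) / real n - G b\<bar> < 1 / real (Suc k)"
        "\<bar>(\<Sum>i=1..n. (G (x i))\<^sup>2) / real n - q\<bar> < 1 / real (Suc k)"
      have "\<not> D n x > \<epsilon>" using neg * by blast
      then show "bl_dist (boot_law I G n x) (normal_law 0 ((q - (G b)\<^sup>2) / (deriv G b)\<^sup>2)) \<le> \<epsilon>"
        by (simp add: D_def)
    qed simp
    with contra show False by simp
  qed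
  then obtain n x where nx: "\<And>k. n k \<ge> Suc k" "\<And>k i. i \<in> {1..n k} \<Longrightarrow> x k i \<in> I"
      "\<And>k. \<bar>(\<Sum>i=1..n k. G (x k i)) / real (n k) - G b\<bar> < 1 / real (Suc k)"
      "\<And>k. \<bar>(\<Sum>i=1..n k. (G (x k i))\<^sup>2) / real (n k) - q\<bar> < 1 / real (Suc k)"
      "\<And>k. D (n k) (x k) > \<epsilon>"
    by metis
  have inv: "(\<lambda>k. 1 / real (Suc k)) \<longlonglongrightarrow> 0" by (rule LIMSEQ_Suc[OF lim_1_over_n])
  have lim: "f \<longlonglongrightarrow> l" if "\<And>k. \<bar>f k - l\<bar> < 1 / real (Suc k)" for f :: "nat \<Rightarrow> real" and l
    by (rule LIM_zero_cancel, rule Lim_null_comparison[OF _ inv]) (use that in \<open>auto intro!: always_eventually less_imp_le simp del: of_nat_Suc\<close>)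
  have "(\<lambda>k. D (n k) (x k)) \<longlonglongrightarrow> 0"
    unfolding D_def
  proof (rule boot_law_tendsto)
    show "filterlim n at_top sequentially"
      by (rule filterlim_at_top_mono[OF filterlim_Suc]) (use nx(1) in auto)
    show "n k > 0" for k using nx(1)[of k] by simp
  qed (use nx(2) lim nx(3,4) in auto)
  then have "\<forall>\<^sub>F k in sequentially. D (n k) (x k) < \<epsilon>" using e by (rule order_tendstoD)
  then obtain k where "D (n k) (x k) < \<epsilon>" by (auto simp: eventually_sequentially)
  with nx(5)[of k] show False by simp
qed

end

section \<open>Random data: convergence in probability\<close>

locale quasi_mean_iid_sample = prob_space M + smooth_quasi_arithmetic_mean I G b U
  for M :: "'a measure" and I G b U +
  fixes X :: "nat \<Rightarrow> 'a \<Rightarrow> real" and Z :: "'a \<Rightarrow> real"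
  assumes X_indep: "indep_vars (\<lambda>_. borel) X {1..}"
    and X_law: "\<And>i. i \<ge> 1 \<Longrightarrow> distr M borel (X i) = distr M borel Z"
    and Z_measurable [measurable]: "Z \<in> borel_measurable M"
    and Z_in: "AE \<omega> in M. Z \<omega> \<in> I"
    and mean_GZ: "expectation (\<lambda>\<omega>. G (Z \<omega>)) = G b"
begin

lemma X_measurable: "i \<ge> 1 \<Longrightarrow> X i \<in> borel_measurable M"
  using X_indep by (simp add: indep_vars_def2)

lemma X_in: "i \<ge> 1 \<Longrightarrow> AE \<omega> in M. X i \<omega> \<in> I"
proof -
  assume i: "i \<ge> 1"
  have I: "I \<in> sets borel" using interval by (rule real_interval_borel_measurable)
  have "AE z in distr M borel Z. z \<in> I"
    using Z_in I by (subst AE_distr_iff) auto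
  then show ?thesis
    unfolding X_law[OF i, symmetric] using X_measurable[OF i] by (rule AE_distrD[rotated])
qed

lemma GZ_in: "AE \<omega> in M. G (Z \<omega>) \<in> {0..1}"
  using Z_in by eventually_elim (use G_range in \<open>auto simp: less_imp_le\<close>)

lemma GZ_integrable: "integrable M (\<lambda>\<omega>. G (Z \<omega>))" "integrable M (\<lambda>\<omega>. (G (Z \<omega>))\<^sup>2)"
proof -
  show "integrable M (\<lambda>\<omega>. G (Z \<omega>))"
    by (rule integrable_const_bound[where B = 1]) (use GZ_in in auto)
  show "integrable M (\<lambda>\<omega>. (G (Z \<omega>))\<^sup>2)"
    by (rule integrable_const_bound[where B = 1], use GZ_in in eventually_elim) (auto simp: power_le_one)
qed

lemma law_compose:
  assumes "i \<ge> 1" and [measurable]: "g \<in> borel_measurable borel"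
  shows "distr M borel (\<lambda>\<omega>. g (X i \<omega>)) = distr M borel (\<lambda>\<omega>. g (Z \<omega>))"
proof -
  note X_measurable[OF assms(1), measurable]
  have "distr (distr M borel (X i)) borel g = distr (distr M borel Z) borel g"
    by (simp only: X_law[OF assms(1)])
  then show ?thesis by (simp add: distr_distr comp_def)
qed

lemma variance_GZ: "variance (\<lambda>\<omega>. G (Z \<omega>)) = expectation (\<lambda>\<omega>. (G (Z \<omega>))\<^sup>2) - (G b)\<^sup>2"
  using variance_eq[OF GZ_integrable] by (simp add: mean_GZ)

abbreviation limit_law :: "real measure" where
  "limit_law \<equiv> normal_law 0 (variance (\<lambda>\<omega>. G (Z \<omega>)) / (deriv G b)\<^sup>2)"

lemma real_distribution_limit_law: "real_distribution limit_law"
  by (rule real_distribution_normal_law) simp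

lemma bootstrap_weak_convergence:
  "tendsto_in_prob M (\<lambda>n \<omega>. bl_dist (boot_law I G n (\<lambda>i. X i \<omega>)) limit_law) 0"
  unfolding tendsto_in_prob_def
proof (intro conjI allI impI)
  show meas: "(\<lambda>\<omega>. bl_dist (boot_law I G n (\<lambda>i. X i \<omega>)) limit_law) \<in> borel_measurable M" for n
    by (rule bl_dist_boot_law_measurable[OF X_measurable real_distribution_limit_law]) simp
  fix \<epsilon> :: real assume "\<epsilon> > 0"
  \<comment> \<open>With this \<open>q\<close>, \<open>variance_GZ\<close> identifies the variance
    in \<open>boot_law_uniform\<close> with that of \<open>limit_law\<close>.\<close>
  define q where "q = expectation (\<lambda>\<omega>. (G (Z \<omega>))\<^sup>2)"
  obtain \<delta> N where \<delta>: "\<delta> > 0" and bound: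
    "\<And>n x. n \<ge> N \<Longrightarrow> (\<And>i. i \<in> {1..n} \<Longrightarrow> x i \<in> I) \<Longrightarrow>
      \<bar>(\<Sum>i=1..n. G (x i)) / real n - G b\<bar> < \<delta> \<Longrightarrow> \<bar>(\<Sum>i=1..n. (G (x i))\<^sup>2) / real n - q\<bar> < \<delta> \<Longrightarrow>
      bl_dist (boot_law I G n x) limit_law \<le> \<epsilon>"
    using boot_law_uniform[OF \<open>\<epsilon> > 0\<close>, of q] unfolding variance_GZ q_def by blast
  define A where "A n = {\<omega>\<in>space M. \<bar>(\<Sum>i=1..n. G (X i \<omega>)) / real n - G b\<bar> \<ge> \<delta>}" for n
  define B where "B n = {\<omega>\<in>space M. \<bar>(\<Sum>i=1..n. (G (X i \<omega>))\<^sup>2) / real n - q\<bar> \<ge> \<delta>}" for n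
  have GX: "(\<lambda>\<omega>. \<Sum>i=1..n. G (X i \<omega>)) \<in> borel_measurable M"
    "(\<lambda>\<omega>. \<Sum>i=1..n. (G (X i \<omega>))\<^sup>2) \<in> borel_measurable M" for n
    by (intro borel_measurable_sum borel_measurable_power measurable_compose[OF X_measurable G_measurable]; simp)+
  note GX[measurable]
  have AB[measurable]: "A n \<in> events" "B n \<in> events" for n unfolding A_def B_def by measurable
  have "(\<lambda>n. prob (A n)) \<longlonglongrightarrow> 0"
    unfolding A_def mean_GZ[symmetric]
    by (rule weak_law_bounded_iid[OF indep_vars_compose2[OF X_indep] law_compose _ GZ_in \<delta>]) auto
  moreover have "(\<lambda>n. prob (B n)) \<longlonglongrightarrow> 0"
    unfolding B_def q_def
  proof (rule weak_law_bounded_iid[OF _ _ _ _ \<delta>])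
    show "indep_vars (\<lambda>_. borel) (\<lambda>i \<omega>. (G (X i \<omega>))\<^sup>2) {1..}"
      by (rule indep_vars_compose2[OF X_indep]) measurable
    show "distr M borel (\<lambda>\<omega>. (G (X i \<omega>))\<^sup>2) = distr M borel (\<lambda>\<omega>. (G (Z \<omega>))\<^sup>2)" if "i \<ge> 1" for i
      by (rule law_compose[OF that]) measurable
    show "AE \<omega> in M. (G (Z \<omega>))\<^sup>2 \<in> {0..1}"
      using GZ_in by eventually_elim (auto simp: power_le_one)
  qed measurable
  ultimately have lim: "(\<lambda>n. prob (A n) + prob (B n)) \<longlonglongrightarrow> 0"
    using tendsto_add by fastforce
  show "(\<lambda>n. prob {\<omega>\<in>space M. \<bar>bl_dist (boot_law I G n (\<lambda>i. X i \<omega>)) limit_law - 0\<bar> > \<epsilon>}) \<longlonglongrightarrow> 0"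
  proof (rule Lim_null_comparison[OF _ lim])
    show "\<forall>\<^sub>F n in sequentially. norm (prob {\<omega>\<in>space M. \<bar>bl_dist (boot_law I G n (\<lambda>i. X i \<omega>)) limit_law - 0\<bar> > \<epsilon>})
        \<le> prob (A n) + prob (B n)"
      using eventually_ge_at_top[of N]
    proof eventually_elim
      case (elim n)
      have all_in: "AE \<omega> in M. \<forall>i\<in>{1..n}. X i \<omega> \<in> I"
        by (rule AE_finite_allI) (use X_in in auto)
      \<comment> \<open>The observations lie in \<open>I\<close> only almost surely, so the bad
        event is contained in \<open>A n \<union> B n\<close> up to a null set.\<close>
      have "AE \<omega> in M. \<omega> \<in> {\<omega>\<in>space M. \<bar>bl_dist (boot_law I G n (\<lambda>i. X i \<omega>)) limit_law - 0\<bar> > \<epsilon>} \<longrightarrow> \<omega> \<in> A n \<union> B n"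
        using all_in
      proof eventually_elim
        case (elim \<omega>)
        note in_I = elim
        show ?case
        proof (intro impI, rule ccontr)
          assume \<omega>: "\<omega> \<in> {\<omega>\<in>space M. \<bar>bl_dist (boot_law I G n (\<lambda>i. X i \<omega>)) limit_law - 0\<bar> > \<epsilon>}" "\<omega> \<notin> A n \<union> B n"
          then have "bl_dist (boot_law I G n (\<lambda>i. X i \<omega>)) limit_law \<le> \<epsilon>"
            using in_I \<open>N \<le> n\<close> by (intro bound) (auto simp: A_def B_def)
          with \<omega>(1) bl_dist_nonneg[OF real_distribution_boot_law real_distribution_limit_law]
          show False by (simp add: abs_of_nonneg)
        qed
      qed
      then have "prob {\<omega>\<in>space M. \<bar>bl_dist (boot_law I G n (\<lambda>i. X i \<omega>)) limit_law - 0\<bar> > \<epsilon>} \<le> prob (A n \<union> B n)"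
        by (rule finite_measure_mono_AE) measurable
      also have "\<dots> \<le> prob (A n) + prob (B n)" by (rule measure_Un_le) measurable
      finally show ?case by simp
    qed
  qed
qed

abbreviation root_law :: "nat \<Rightarrow> real measure" where
  "root_law n \<equiv> distr M borel (\<lambda>\<omega>. sqrt (real n) * (gmean I G n (\<lambda>i. X i \<omega>) - b))"

lemma real_distribution_root_law: "real_distribution (root_law n)"
  by (rule real_distribution_distr, intro borel_measurable_times borel_measurable_diff gmean_measurable)
    (auto intro: X_measurable)

lemma root_law_tendsto: "(\<lambda>n. bl_dist (root_law n) limit_law) \<longlonglongrightarrow> 0"
proof -
  define \<nu> where "\<nu> = distr M borel (\<lambda>\<omega>. G (Z \<omega>))"
  have "(\<lambda>n. bl_dist (distr M borel (\<lambda>\<omega>. sqrt (real n) * (H ((\<Sum>i=1..n. G (X i \<omega>)) / real n) - H (G b))))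
      limit_law) \<longlonglongrightarrow> 0"
  proof (rule quasi_mean_root_clt[where \<nu> = "\<lambda>_. \<nu>" and m = "\<lambda>_. G b" and n = "\<lambda>n. n", OF prob_space_axioms])
    show "indep_vars (\<lambda>_. borel) (\<lambda>i \<omega>. G (X i \<omega>)) {1..n}" for n
      by (rule indep_vars_subset[OF indep_vars_compose2[OF X_indep]]) auto
    show "distr M borel (\<lambda>\<omega>. G (X i \<omega>)) = \<nu>" if "i \<in> {1..n}" for i n
      unfolding \<nu>_def using that by (intro law_compose) auto
    show "real_distribution \<nu>" unfolding \<nu>_def by (rule real_distribution_distr) measurable
    show "AE z in \<nu>. z \<in> {0..1}" unfolding \<nu>_def using GZ_in by (subst AE_distr_iff) auto
    show "G b = (\<integral>z. z \<partial>\<nu>)" unfolding \<nu>_def by (subst integral_distr) (auto simp: mean_GZ)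
    have "(\<integral>z. (z - G b)\<^sup>2 \<partial>\<nu>) = variance (\<lambda>\<omega>. G (Z \<omega>))"
      unfolding \<nu>_def by (subst integral_distr) (auto simp: mean_GZ)
    then show "(\<lambda>k. \<integral>z. (z - G b)\<^sup>2 \<partial>\<nu>) \<longlonglongrightarrow> variance (\<lambda>\<omega>. G (Z \<omega>))" by simp
  qed (auto simp: filterlim_ident)
  moreover have "H (G b) = b" using U by (intro H_G) auto
  ultimately show ?thesis by (simp add: gmean_def)
qed

text \<open>\<open>root_law n\<close> is not random: once it is within \<open>\<epsilon> / 2\<close>
  of the limit, a deviation above \<open>\<epsilon>\<close> from it forces one above
  \<open>\<epsilon> / 2\<close> from \<open>limit_law\<close>.\<close>

lemma bootstrap_consistent:
  "tendsto_in_prob M (\<lambda>n \<omega>. bl_dist (boot_law I G n (\<lambda>i. X i \<omega>)) (root_law n)) 0"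
  unfolding tendsto_in_prob_def
proof (intro conjI allI impI)
  show "(\<lambda>\<omega>. bl_dist (boot_law I G n (\<lambda>i. X i \<omega>)) (root_law n)) \<in> borel_measurable M" for n
    by (rule bl_dist_boot_law_measurable[OF X_measurable real_distribution_root_law]) simp
  fix \<epsilon> :: real assume e: "\<epsilon> > 0"
  have meas: "(\<lambda>\<omega>. bl_dist (boot_law I G n (\<lambda>i. X i \<omega>)) limit_law) \<in> borel_measurable M" for n
    using bootstrap_weak_convergence by (simp add: tendsto_in_prob_def)
  note meas[measurable]
  have lim: "(\<lambda>n. prob {\<omega>\<in>space M. \<bar>bl_dist (boot_law I G n (\<lambda>i. X i \<omega>)) limit_law - 0\<bar> > \<epsilon> / 2}) \<longlonglongrightarrow> 0"
    using bootstrap_weak_convergence e unfolding tendsto_in_prob_def by (meson half_gt_zero)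
  show "(\<lambda>n. prob {\<omega>\<in>space M. \<bar>bl_dist (boot_law I G n (\<lambda>i. X i \<omega>)) (root_law n) - 0\<bar> > \<epsilon>}) \<longlonglongrightarrow> 0"
  proof (rule Lim_null_comparison[OF _ lim])
    have "\<forall>\<^sub>F n in sequentially. bl_dist (root_law n) limit_law < \<epsilon> / 2"
      using e by (intro order_tendstoD(2)[OF root_law_tendsto]) simp
    then show "\<forall>\<^sub>F n in sequentially.
        norm (prob {\<omega>\<in>space M. \<bar>bl_dist (boot_law I G n (\<lambda>i. X i \<omega>)) (root_law n) - 0\<bar> > \<epsilon>})
        \<le> prob {\<omega>\<in>space M. \<bar>bl_dist (boot_law I G n (\<lambda>i. X i \<omega>)) limit_law - 0\<bar> > \<epsilon> / 2}"
    proof eventually_elim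
      case (elim n)
      have "\<bar>bl_dist (boot_law I G n x) limit_law\<bar> > \<epsilon> / 2"
        if "\<bar>bl_dist (boot_law I G n x) (root_law n)\<bar> > \<epsilon>" for x
        using that elim bl_dist_triangle[OF real_distribution_boot_law real_distribution_limit_law real_distribution_root_law,
            of I G n x n] bl_dist_commute[of limit_law "root_law n"]
          bl_dist_nonneg[OF real_distribution_boot_law real_distribution_root_law, of I G n x n]
        by linarith
      then show ?case
        unfolding real_norm_def abs_of_nonneg[OF measure_nonneg] diff_0_right
        by (intro finite_measure_mono) auto
    qed
  qed
qed

end

theorem theorem3p6:
  fixes M :: "'a measure" and P :: "real measure"
    and X0 :: "'a \<Rightarrow> real" and X :: "nat \<Rightarrow> 'a \<Rightarrow> real"
    and I :: "real set" and G :: "real \<Rightarrow> real"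
    and p b \<tau>2 :: real
  assumes interval: "is_interval I"
    and G_fun: "G \<in> I \<rightarrow>\<^sub>E {0<..<1}"
    and G_cont: "continuous_on I G"
    and G_mono: "strict_mono_on I G"
    and G_bij: "bij_betw G I {0<..<1}"
    and M: "prob_space M"
    and indep: "prob_space.indep_vars M (\<lambda>_. borel) (case_nat X0 (\<lambda>i. X (Suc i))) UNIV"
    and law_X0: "distr M borel X0 = P"
    and law_X: "\<And>i. i \<ge> 1 \<Longrightarrow> distr M borel (X i) = P"
    and P_I: "measure P I = 1"
    and p_eq: "p = prob_space.expectation M (\<lambda>\<omega>. G (X0 \<omega>))"
    and b_eq: "b = the_inv_into I G p"
    and G_C1: "\<exists>U. open U \<and> b \<in> U \<and> U \<subseteq> I \<and>
                 (\<forall>x\<in>U. G field_differentiable (at x)) \<and> continuous_on U (deriv G)"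
    and G_deriv_pos: "deriv G b > 0"
    and \<tau>2_eq: "\<tau>2 = prob_space.variance M (\<lambda>\<omega>. G (X0 \<omega>)) / (deriv G b)\<^sup>2"
  shows "cond_weak_conv_in_prob M (\<lambda>n \<omega>. boot_law I G n (\<lambda>i. X i \<omega>)) (normal_law 0 \<tau>2) \<and>
         tendsto_in_prob M
           (\<lambda>n \<omega>. bl_dist (boot_law I G n (\<lambda>i. X i \<omega>))
              (distr M borel (\<lambda>\<omega>'. sqrt (real n) * (gmean I G n (\<lambda>i. X i \<omega>') - b))))
           0"
proof -
  interpret prob_space M by (rule M)
  interpret quasi_arithmetic_mean I G
    by unfold_locales (fact interval G_fun G_cont G_mono G_bij)+
  obtain U where U: "open U" "b \<in> U" "U \<subseteq> I" "\<And>x. x \<in> U \<Longrightarrow> G field_differentiable (at x)"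
    "continuous_on U (deriv G)" using G_C1 by blast
  have X0_meas[measurable]: "X0 \<in> borel_measurable M"
    using indep_vars_def2[THEN iffD1, OF indep] by (auto dest: spec[of _ 0])
  have "AE z in distr M borel X0. z \<in> I"
    unfolding law_X0
    by (rule prob_space.AE_prob_1[OF _ P_I]) (use prob_space_distr[OF X0_meas] law_X0 in simp)
  then have X0_in: "AE \<omega> in M. X0 \<omega> \<in> I" by (rule AE_distrD[OF X0_meas])
  have X0_range: "AE \<omega> in M. 0 < G (X0 \<omega>)" "AE \<omega> in M. G (X0 \<omega>) < 1"
    using X0_in by (eventually_elim, use G_range in auto)+
  have int: "integrable M (\<lambda>\<omega>. G (X0 \<omega>))"
    by (rule integrable_const_bound[where B = 1], use X0_range in eventually_elim) auto
  \<comment> \<open>Strict bounds on \<open>p\<close> are essential: \<open>H\<close> inverts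
    \<open>G\<close> only on (0,1), and they turn the definition of \<open>b\<close> into
    \<open>G b = p\<close>. Strictness survives integration since \<open>G (X0 \<omega>)\<close> is
    almost surely strictly inside (0,1).\<close>
  have "expectation (\<lambda>_. 0) < p"
    unfolding p_eq by (rule integral_less_AE_space[OF _ int]) (use X0_range in \<open>auto simp: emeasure_space_1\<close>)
  moreover have "p < expectation (\<lambda>_. 1)"
    unfolding p_eq by (rule integral_less_AE_space[OF int]) (use X0_range in \<open>auto simp: emeasure_space_1\<close>)
  ultimately have Gb: "G b = p" unfolding b_eq by (intro G_H) (auto simp: prob_space)
  interpret quasi_mean_iid_sample M I G b U X X0
  proof unfold_locales
    \<comment> \<open>In the joint family slot 0 holds \<open>X0\<close>, and slot \<open>i\<close>
      holds \<open>X i\<close> for positive \<open>i\<close>; restricting to \<open>{1..}\<close>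
      leaves the sample.\<close>
    have "indep_vars (\<lambda>_. borel) (case_nat X0 (\<lambda>i. X (Suc i))) {1..}"
      by (rule indep_vars_subset[OF indep]) simp
    also have "?this \<longleftrightarrow> indep_vars (\<lambda>_. borel) X {1..}"
      by (rule indep_vars_cong) (auto split: nat.split)
    finally show "indep_vars (\<lambda>_. borel) X {1..}" .
  qed (use U G_deriv_pos law_X law_X0 X0_in p_eq Gb in auto)
  show ?thesis
    unfolding cond_weak_conv_in_prob_def \<tau>2_eq
    using bootstrap_weak_convergence bootstrap_consistent by blast
qed

end
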